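(* Let $n\ge 1$ and let $A,B,Z$ be $n\times n$ complex matrices such that the product $AB$ is positive semidefinite and $Z$ is positive definite with largest eigenvalue $a$ and smallest eigenvalue $b$. Then for every unitarily invariant norm $\Vert\cdot\Vert$ on $n\times n$ complex matrices, $$\Vert ZAB\Vert \le \frac{a+b}{2\sqrt{ab}}\,\Vert BZA\Vert,$$ and this inequality is sharp (the constant $\frac{a+b}{2\sqrt{ab}}$ cannot be replaced by a smaller one in general).
   Context: A norm $\Vert\cdot\Vert$ on $n\times n$ complex matrices is unitarily invariant (symmetric) if $\Vert UXV\Vert=\Vert X\Vert$ for all matrices $X$ and all unitary $U,V$. "$AB$ positive semidefinite" means $AB$ is Hermitian with nonnegative eigenvalues. *)

theory Defs
  imports "Jordan_Normal_Form.Schur_Decomposition"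
begin

definition hermitian_mat :: "nat \<Rightarrow> complex mat \<Rightarrow> bool" where
  "hermitian_mat n M \<longleftrightarrow> M \<in> carrier_mat n n \<and> mat_adjoint M = M"

definition psd_mat :: "nat \<Rightarrow> complex mat \<Rightarrow> bool" where
  "psd_mat n M \<longleftrightarrow> hermitian_mat n M \<and>
     (\<forall>e. eigenvalue M e \<longrightarrow> e \<in> \<real> \<and> Re e \<ge> 0)"

definition pd_mat :: "nat \<Rightarrow> complex mat \<Rightarrow> bool" where
  "pd_mat n M \<longleftrightarrow> hermitian_mat n M \<and>
     (\<forall>e. eigenvalue M e \<longrightarrow> e \<in> \<real> \<and> Re e > 0)"

definition largest_eigenvalue :: "complex mat \<Rightarrow> real \<Rightarrow> bool" where
  "largest_eigenvalue M a \<longleftrightarrow> eigenvalue M (complex_of_real a) \<and>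
     (\<forall>e. eigenvalue M e \<longrightarrow> Re e \<le> a)"

definition smallest_eigenvalue :: "complex mat \<Rightarrow> real \<Rightarrow> bool" where
  "smallest_eigenvalue M b \<longleftrightarrow> eigenvalue M (complex_of_real b) \<and>
     (\<forall>e. eigenvalue M e \<longrightarrow> b \<le> Re e)"

definition unitary_mat :: "nat \<Rightarrow> complex mat \<Rightarrow> bool" where
  "unitary_mat n U \<longleftrightarrow> U \<in> carrier_mat n n \<and> mat_adjoint U * U = 1\<^sub>m n"

definition matrix_norm_on :: "nat \<Rightarrow> (complex mat \<Rightarrow> real) \<Rightarrow> bool" where
  "matrix_norm_on n N \<longleftrightarrow>
     (\<forall>X \<in> carrier_mat n n. N X \<ge> 0) \<and>
     (\<forall>X \<in> carrier_mat n n. N X = 0 \<longleftrightarrow> X = 0\<^sub>m n n) \<and>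
     (\<forall>X \<in> carrier_mat n n. \<forall>c::complex. N (c \<cdot>\<^sub>m X) = cmod c * N X) \<and>
     (\<forall>X \<in> carrier_mat n n. \<forall>Y \<in> carrier_mat n n. N (X + Y) \<le> N X + N Y)"

definition unitarily_invariant_norm :: "nat \<Rightarrow> (complex mat \<Rightarrow> real) \<Rightarrow> bool" where
  "unitarily_invariant_norm n N \<longleftrightarrow> matrix_norm_on n N \<and>
     (\<forall>X \<in> carrier_mat n n. \<forall>U V. unitary_mat n U \<longrightarrow> unitary_mat n V \<longrightarrow>
        N (U * X * V) = N X)"

end

theory Submission
  imports Defs
begin

text \<open>Write \<open>A B = Q Q\<^sup>*\<close>. A unitary factor makes \<open>Z Q Q\<^sup>*\<close> positive semidefinite, and the
  arithmetic-geometric mean inequality for unitarily invariant norms, applied to multiples of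
  \<open>Z Q\<close> and \<open>Q\<close>, bounds \<open>2 \<surd>(a b) \<parallel>Z A B\<parallel>\<close> by \<open>\<parallel>Q\<^sup>* (Z\<^sup>2 + a b) Q\<parallel>\<close>. Since
  \<open>(a - Z) (Z - b)\<close> is positive semidefinite, this is at most \<open>(a + b) \<parallel>Q\<^sup>* Z Q\<parallel>\<close>. Finally
  \<open>Q\<^sup>* Z Q\<close> is Hermitian with the same characteristic polynomial as \<open>B Z A\<close>, so its eigenvalues
  are the diagonal of a Schur form of \<open>B Z A\<close>, and deleting off-diagonal entries does not increase
  the norm. Equality holds for \<open>A = B = u u\<^sup>*\<close> with \<open>u = \<surd>b x + \<surd>a y\<close>, where \<open>x\<close> and \<open>y\<close> are
  orthonormal eigenvectors of \<open>Z\<close> for \<open>a\<close> and \<open>b\<close>.\<close>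

section \<open>Unitary matrices\<close>

text \<open>With all dimensions equal, every variable of the premises occurs in the conclusion, so
  the simplifier can apply the rule directly; in \<open>mult_carrier_mat\<close> the inner dimension
  would have to be guessed.\<close>

lemma mult_carrier_square [simp]:
  "A \<in> carrier_mat n n \<Longrightarrow> B \<in> carrier_mat n n \<Longrightarrow> A * B \<in> carrier_mat n n"
  by (rule mult_carrier_mat)

lemma mat_adjoint_dim [simp]:
  "dim_row (mat_adjoint A) = dim_col A" "dim_col (mat_adjoint A) = dim_row A"
  unfolding mat_adjoint_def by auto

lemma mat_adjoint_carrier [simp]: "A \<in> carrier_mat n m \<Longrightarrow> mat_adjoint A \<in> carrier_mat m n"
  unfolding mat_adjoint_def by auto

lemma mat_adjoint_index [simp]:
  "i < dim_col A \<Longrightarrow> j < dim_row A \<Longrightarrow> mat_adjoint A $$ (i, j) = conjugate (A $$ (j, i))"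
  unfolding mat_adjoint_def by (simp add: mat_of_rows_index)

lemma mat_adjoint_adjoint [simp]: "mat_adjoint (mat_adjoint A) = A"
  by (rule eq_matI) auto

lemma mat_adjoint_one [simp]: "mat_adjoint (1\<^sub>m n) = (1\<^sub>m n :: complex mat)"
  by (rule eq_matI) auto

lemma mat_adjoint_mult:
  fixes A B :: "complex mat"
  assumes "A \<in> carrier_mat n m" "B \<in> carrier_mat m k"
  shows "mat_adjoint (A * B) = mat_adjoint B * mat_adjoint A"
  using assms by (intro eq_matI) (auto simp: scalar_prod_def mult.commute intro!: sum.cong)

lemma mat_adjoint_add:
  fixes A B :: "complex mat"
  assumes "A \<in> carrier_mat n m" "B \<in> carrier_mat n m"
  shows "mat_adjoint (A + B) = mat_adjoint A + mat_adjoint B"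
  using assms by (intro eq_matI) auto

lemma mat_adjoint_smult:
  fixes A :: "complex mat"
  shows "mat_adjoint (c \<cdot>\<^sub>m A) = cnj c \<cdot>\<^sub>m mat_adjoint A"
  by (intro eq_matI) auto

lemma mat_adjoint_four_block:
  fixes A B C D :: "complex mat"
  assumes "A \<in> carrier_mat n1 m1" "B \<in> carrier_mat n1 m2" "C \<in> carrier_mat n2 m1" "D \<in> carrier_mat n2 m2"
  shows "mat_adjoint (four_block_mat A B C D) =
    four_block_mat (mat_adjoint A) (mat_adjoint C) (mat_adjoint B) (mat_adjoint D)"
  using assms by (intro eq_matI) auto

text \<open>The definition asks for a left inverse only; for square matrices a left inverse is also
  a right inverse.\<close>

lemma unitary_matD:
  assumes "unitary_mat n U"
  shows "U \<in> carrier_mat n n" "mat_adjoint U * U = 1\<^sub>m n" "U * mat_adjoint U = 1\<^sub>m n"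
  using assms mat_mult_left_right_inverse[of "mat_adjoint U" n U]
  unfolding unitary_mat_def by auto

lemma unitary_mat_one [simp]: "unitary_mat n (1\<^sub>m n)"
  unfolding unitary_mat_def by simp

lemma unitary_mat_adjoint: "unitary_mat n U \<Longrightarrow> unitary_mat n (mat_adjoint U)"
  using unitary_matD[of n U] unfolding unitary_mat_def by simp

text \<open>Nested to the right because rewriting with \<open>assoc_mult_mat\<close> leaves products
  in that shape; \<open>cancel_adjoint_right\<close> serves products nested to the left.\<close>

lemma cancel_adjoint:
  assumes "unitary_mat n U" "X \<in> carrier_mat n m"
  shows "mat_adjoint U * (U * X) = X" "U * (mat_adjoint U * X) = X"
proof -
  note U = unitary_matD[OF assms(1)]
  have "mat_adjoint U * (U * X) = (mat_adjoint U * U) * X"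
    using U(1) assms(2) by (intro assoc_mult_mat[symmetric]) auto
  thus "mat_adjoint U * (U * X) = X" using U assms by simp
  have "U * (mat_adjoint U * X) = (U * mat_adjoint U) * X"
    using U(1) assms(2) by (intro assoc_mult_mat[symmetric]) auto
  thus "U * (mat_adjoint U * X) = X" using U assms by simp
qed

lemma cancel_adjoint_right:
  assumes "unitary_mat n U" "X \<in> carrier_mat m n"
  shows "X * mat_adjoint U * U = X" "X * U * mat_adjoint U = X"
proof -
  note U = unitary_matD[OF assms(1)]
  have "X * mat_adjoint U * U = X * (mat_adjoint U * U)"
    using U(1) assms(2) by (intro assoc_mult_mat) auto
  thus "X * mat_adjoint U * U = X" using U assms by simp
  have "X * U * mat_adjoint U = X * (U * mat_adjoint U)"
    using U(1) assms(2) by (intro assoc_mult_mat) auto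
  thus "X * U * mat_adjoint U = X" using U assms by simp
qed

lemma unitary_mat_mult:
  assumes "unitary_mat n U" "unitary_mat n V"
  shows "unitary_mat n (U * V)"
proof -
  note U = unitary_matD[OF assms(1)] and V = unitary_matD[OF assms(2)]
  have "mat_adjoint (U * V) * (U * V) = mat_adjoint V * (mat_adjoint U * (U * V))"
    using U(1) V(1) by (simp add: mat_adjoint_mult assoc_mult_mat[of _ n n _ n _ n])
  thus ?thesis using U V cancel_adjoint[OF assms(1) V(1)] unfolding unitary_mat_def by simp
qed

text \<open>Lifts the unitary matrix found for the lower right block back to full size in the
  induction of \<open>unitary_schur\<close>.\<close>

lemma unitary_mat_four_block:
  assumes "unitary_mat n U"
  shows "unitary_mat (Suc n) (four_block_mat (1\<^sub>m 1) (0\<^sub>m 1 n) (0\<^sub>m n 1) U)"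
proof -
  note U = unitary_matD[OF assms]
  have z: "mat_adjoint (0\<^sub>m k l) = (0\<^sub>m l k :: complex mat)" for k l
    by (intro eq_matI) auto
  have "mat_adjoint (four_block_mat (1\<^sub>m 1) (0\<^sub>m 1 n) (0\<^sub>m n 1) U) *
      four_block_mat (1\<^sub>m 1) (0\<^sub>m 1 n) (0\<^sub>m n 1) U
     = four_block_mat (1\<^sub>m 1) (0\<^sub>m 1 n) (0\<^sub>m n 1) (1\<^sub>m n)"
    using U by (subst mat_adjoint_four_block[of _ 1 1 _ n _ n])
      (auto simp: z mult_four_block_mat[of _ 1 1 _ n _ n _ _ 1 _ n])
  also have "\<dots> = 1\<^sub>m (Suc n)" using four_block_one_mat[of 1 n] by simp
  finally show ?thesis using U(1) unfolding unitary_mat_def by auto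
qed

text \<open>The sum is the (i, j) entry of the square of I - c w w^*. Once c^2 times the squared
  norm of w equals 2 c, the last two terms cancel and the square is the identity.\<close>

lemma sum_delta_diff:
  fixes w :: "nat \<Rightarrow> complex"
  assumes "i < n" "j < n"
  shows "(\<Sum>k<n. ((if i = k then 1 else 0) - c * w i * cnj (w k)) *
                 ((if k = j then 1 else 0) - c * w k * cnj (w j)))
       = (if i = j then 1 else 0) - 2 * c * w i * cnj (w j)
         + c * c * w i * cnj (w j) * (\<Sum>k<n. cnj (w k) * w k)"
proof -
  have "(\<Sum>k<n. ((if i = k then 1 else 0) - c * w i * cnj (w k)) *
                 ((if k = j then 1 else 0) - c * w k * cnj (w j)))
      = (\<Sum>k<n. (if i = k then (if i = j then 1 else 0) else 0)
            - (if i = k then c * w i * cnj (w j) else 0)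
            - (if k = j then c * w i * cnj (w j) else 0)
            + c * c * w i * cnj (w j) * (cnj (w k) * w k))"
    by (intro sum.cong) (auto simp: algebra_simps)
  also have "\<dots> = (if i = j then 1 else 0) - 2 * c * w i * cnj (w j)
         + c * c * w i * cnj (w j) * (\<Sum>k<n. cnj (w k) * w k)"
    using assms by (simp add: sum.distrib sum_subtractf sum_distrib_left)
  finally show ?thesis .
qed

text \<open>Householder reflection along \<open>x - y\<close>.\<close>

lemma unitary_mat_maps_to:
  fixes x y :: "complex vec"
  assumes x: "x \<in> carrier_vec n" and y: "y \<in> carrier_vec n"
    and norm: "x \<bullet>c x = y \<bullet>c y" and real: "x \<bullet>c y = y \<bullet>c x"
  obtains U where "unitary_mat n U" "mat_adjoint U = U" "U *\<^sub>v x = y"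
proof -
  define w where "w = (\<lambda>i. x $ i - y $ i)"
  define s where "s = (\<Sum>k<n. cnj (w k) * w k)"
  \<comment> \<open>If x = y then s = 0, division by zero gives c = 0, and U is the identity; the
    equation \<open>ccs\<close> thus holds without a case split.\<close>
  define c where "c = 2 / s"
  define U where "U = mat n n (\<lambda>(i,j). (if i = j then 1 else 0) - c * w i * cnj (w j))"
  have s_real: "s = complex_of_real (\<Sum>k<n. (cmod (w k))\<^sup>2)"
    unfolding s_def of_real_sum by (intro sum.cong refl) (simp add: complex_norm_square mult.commute del: of_real_power)
  have c_real: "cnj c = c" unfolding c_def s_real by simp
  have ccs: "c * c * s = 2 * c" unfolding c_def by simp
  have adj: "mat_adjoint U = U"
    unfolding U_def by (intro eq_matI) (auto simp: c_real)
  have sp: "a \<bullet>c b = (\<Sum>k<n. a $ k * cnj (b $ k))" if "b \<in> carrier_vec n" for a b :: "complex vec"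
    using that by (auto simp: scalar_prod_def lessThan_atLeast0 intro!: sum.cong)
  have "U * U = 1\<^sub>m n"
  proof (rule eq_matI)
    fix i j assume ij: "i < dim_row (1\<^sub>m n)" "j < dim_col (1\<^sub>m n :: complex mat)"
    have "(U * U) $$ (i,j) = (\<Sum>k<n. ((if i = k then 1 else 0) - c * w i * cnj (w k)) *
                 ((if k = j then 1 else 0) - c * w k * cnj (w j)))"
      using ij unfolding U_def by (simp add: scalar_prod_def lessThan_atLeast0)
    also have "\<dots> = (if i = j then 1 else 0) - 2 * c * w i * cnj (w j) + (c * c * s) * w i * cnj (w j)"
      using ij by (subst sum_delta_diff) (auto simp: s_def)
    also have "\<dots> = (1\<^sub>m n) $$ (i,j)" using ij by (simp add: ccs)
    finally show "(U * U) $$ (i,j) = (1\<^sub>m n) $$ (i,j)" .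
  qed (auto simp: U_def)
  hence un: "unitary_mat n U" unfolding unitary_mat_def adj by (simp add: U_def)
  have wx: "(\<Sum>k<n. cnj (w k) * x $ k) = x \<bullet>c x - x \<bullet>c y"
    unfolding sp[OF x] sp[OF y] w_def by (simp add: algebra_simps sum_subtractf)
  have "s = x \<bullet>c x - x \<bullet>c y - y \<bullet>c x + y \<bullet>c y"
    unfolding s_def sp[OF x] sp[OF y] w_def by (simp add: algebra_simps sum_subtractf sum.distrib)
  \<comment> \<open>Equality of the norms and of the two inner products makes s twice the inner
    product of x with w, so the reflection subtracts exactly w = x - y from x.\<close>
  hence s2: "s = 2 * (\<Sum>k<n. cnj (w k) * x $ k)" unfolding wx using norm real by simp
  have w0: "w i = 0" if "s = 0" "i < n" for i
  proof -
    have "(\<Sum>k<n. (cmod (w k))\<^sup>2) = 0" using that s_real by (metis of_real_eq_0_iff)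
    thus ?thesis using that by (simp add: sum_nonneg_eq_0_iff)
  qed
  have "U *\<^sub>v x = y"
  proof (rule eq_vecI)
    fix i assume "i < dim_vec y"
    hence i: "i < n" using y by simp
    have "(U *\<^sub>v x) $ i = (\<Sum>k<n. ((if i = k then 1 else 0) - c * w i * cnj (w k)) * x $ k)"
      using i x unfolding U_def by (simp add: scalar_prod_def lessThan_atLeast0)
    also have "\<dots> = (\<Sum>k<n. (if i = k then x $ i else 0) - c * w i * (cnj (w k) * x $ k))"
      by (intro sum.cong) (auto simp: algebra_simps)
    also have "\<dots> = x $ i - c * w i * (\<Sum>k<n. cnj (w k) * x $ k)"
      using i by (simp add: sum_subtractf flip: sum_distrib_left)
    also have "(\<Sum>k<n. cnj (w k) * x $ k) = s / 2" using s2 by simp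
    also have "x $ i - c * w i * (s / 2) = y $ i"
      using w0[OF _ i] by (cases "s = 0") (auto simp: c_def w_def field_simps)
    finally show "(U *\<^sub>v x) $ i = y $ i" .
  qed (use x y in \<open>auto simp: U_def\<close>)
  thus thesis using that un adj by blast
qed

section \<open>Schur form and spectral theorem\<close>

lemma conjugate_square_real: "(x :: complex vec) \<bullet>c x = complex_of_real (\<Sum>k<dim_vec x. (cmod (x $ k))\<^sup>2)"
  unfolding scalar_prod_def of_real_sum lessThan_atLeast0
  by (auto intro!: sum.cong simp: complex_norm_square simp del: of_real_power)

text \<open>A Householder reflection can reach a multiple of v that is a unit vector and has a real
  inner product with the first unit vector; the scalar c arranges both.\<close>

lemma unitary_mat_first_column:
  fixes v :: "complex vec"
  assumes v: "v \<in> carrier_vec (Suc n)" and v0: "v \<noteq> 0\<^sub>v (Suc n)"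
  obtains U c where "unitary_mat (Suc n) U" "c \<noteq> 0" "U *\<^sub>v unit_vec (Suc n) 0 = c \<cdot>\<^sub>v v"
proof -
  define s where "s = (\<Sum>k<Suc n. (cmod (v $ k))\<^sup>2)"
  have s: "v \<bullet>c v = complex_of_real s" unfolding conjugate_square_real s_def using v by simp
  have s0: "s \<noteq> 0" using conjugate_square_eq_0_vec[OF v] v0 s by auto
  have s_pos: "s > 0" using s0 unfolding s_def by (simp add: less_le sum_nonneg)
  \<comment> \<open>The phase that turns the first entry of v into its modulus; any phase would do
    when that entry is zero.\<close>
  define p where "p = (if v $ 0 = 0 then 1 else cnj (v $ 0) / cmod (v $ 0))"
  define c where "c = p / sqrt s"
  have p1: "cmod p = 1" unfolding p_def by (simp add: norm_divide)
  have c0: "c \<noteq> 0" using p1 s_pos unfolding c_def by auto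
  have cs: "cmod c ^ 2 * s = 1" unfolding c_def using s_pos p1 by (simp add: norm_divide power_divide)
  have pv: "p * v $ 0 = cmod (v $ 0)"
    unfolding p_def by (simp add: complex_norm_square[symmetric] mult.commute)
      (simp add: power2_eq_square)
  define y where "y = c \<cdot>\<^sub>v v"
  have y: "y \<in> carrier_vec (Suc n)" using v unfolding y_def by simp
  have y0: "y $ 0 = complex_of_real (cmod (v $ 0) / sqrt s)"
    using v pv unfolding y_def c_def by (simp add: field_simps)
  have yy: "y \<bullet>c y = 1"
  proof -
    have "y \<bullet>c y = complex_of_real (\<Sum>k<Suc n. (cmod (c * v $ k))\<^sup>2)"
      using v unfolding conjugate_square_real y_def by simp
    also have "(\<Sum>k<Suc n. (cmod (c * v $ k))\<^sup>2) = cmod c ^ 2 * s"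
      unfolding s_def sum_distrib_left by (simp add: norm_mult power_mult_distrib)
    finally show ?thesis using cs by simp
  qed
  have e: "unit_vec (Suc n) 0 \<in> carrier_vec (Suc n)" by simp
  obtain U where "unitary_mat (Suc n) U" "mat_adjoint U = U" "U *\<^sub>v unit_vec (Suc n) 0 = y"
  proof (rule unitary_mat_maps_to[OF e y])
    have ce: "conjugate (unit_vec (Suc n) 0) = (unit_vec (Suc n) 0 :: complex vec)"
      by (intro eq_vecI) (auto simp: unit_vec_def)
    have "unit_vec (Suc n) 0 \<bullet>c (unit_vec (Suc n) 0 :: complex vec) = 1"
      unfolding ce using e by (subst scalar_prod_left_unit) auto
    thus "unit_vec (Suc n) 0 \<bullet>c (unit_vec (Suc n) 0 :: complex vec) = y \<bullet>c y"
      unfolding yy .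
    show "unit_vec (Suc n) 0 \<bullet>c y = y \<bullet>c unit_vec (Suc n) 0"
      unfolding ce using e y y0 by (subst scalar_prod_left_unit, simp, simp,
         subst scalar_prod_right_unit) auto
  qed
  thus thesis using that[OF _ c0] unfolding y_def by blast
qed

text \<open>Induction on the list of roots: an eigenvector for the first root becomes, up to a
  factor, the first column of a unitary matrix, and the remaining block has the remaining roots. The
  diagonal comes out in the prescribed order, so two matrices with one characteristic polynomial can
  be given the same diagonal.\<close>

lemma unitary_schur:
  fixes A :: "complex mat"
  assumes "A \<in> carrier_mat n n" "char_poly A = (\<Prod>e\<leftarrow>es. [:- e, 1:])"
  shows "\<exists>U. unitary_mat n U \<and> upper_triangular (mat_adjoint U * A * U) \<and>
             diag_mat (mat_adjoint U * A * U) = es"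
  using assms
proof (induction es arbitrary: n A)
  case Nil
  hence "n = 0" using degree_monic_char_poly[OF Nil(1)] by simp
  thus ?case using Nil(1) by (intro exI[of _ "1\<^sub>m n"]) (auto simp: diag_mat_def)
next
  case (Cons e es)
  have "degree (\<Prod>e\<leftarrow>(e # es). [:- e, 1:]) = length (e # es)" by (rule degree_linear_factors)
  hence "n = Suc (length es)" using degree_monic_char_poly[OF Cons.prems(1)] Cons.prems(2) by simp
  then obtain m where n: "n = Suc m" by blast
  note A = Cons.prems(1)[unfolded n]
  have "eigenvalue A e" unfolding eigenvalue_root_char_poly[OF A] Cons.prems(2) by simp
  then obtain v where v: "v \<in> carrier_vec (Suc m)" "v \<noteq> 0\<^sub>v (Suc m)" "A *\<^sub>v v = e \<cdot>\<^sub>v v"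
    unfolding eigenvalue_def eigenvector_def using A by auto
  obtain U c where U: "unitary_mat (Suc m) U" and c: "c \<noteq> 0"
    and Uv: "U *\<^sub>v unit_vec (Suc m) 0 = c \<cdot>\<^sub>v v"
    using unitary_mat_first_column[OF v(1,2)] by blast
  note U' = unitary_matD[OF U]
  define A' where "A' = mat_adjoint U * A * U"
  have A': "A' \<in> carrier_mat (Suc m) (Suc m)" using U' A unfolding A'_def by simp
  define u0 :: "complex vec" where "u0 = unit_vec (Suc m) 0"
  have u0: "u0 \<in> carrier_vec (Suc m)" unfolding u0_def by simp
  have "A' *\<^sub>v u0 = mat_adjoint U *\<^sub>v (A *\<^sub>v (U *\<^sub>v u0))"
    using U' A u0 unfolding A'_def
    by (simp add: assoc_mult_mat_vec[of _ "Suc m" "Suc m" _ "Suc m"] mult_mat_vec_carrier[of _ "Suc m" "Suc m"])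
  also have "A *\<^sub>v (U *\<^sub>v u0) = e \<cdot>\<^sub>v (U *\<^sub>v u0)"
    unfolding u0_def Uv using v A by (simp add: mult_mat_vec smult_smult_assoc mult.commute)
  also have "mat_adjoint U *\<^sub>v (e \<cdot>\<^sub>v (U *\<^sub>v u0)) = e \<cdot>\<^sub>v ((mat_adjoint U * U) *\<^sub>v u0)"
    using U'(1) u0 by (subst mult_mat_vec[of _ "Suc m" "Suc m"]) (auto simp: assoc_mult_mat_vec[of _ "Suc m" "Suc m" _ "Suc m"])
  finally have ev: "A' *\<^sub>v u0 = e \<cdot>\<^sub>v u0" using U' u0 by simp
  have col0: "A' $$ (i, 0) = (if i = 0 then e else 0)" if "i < Suc m" for i
  proof -
    have "A' $$ (i, 0) = (A' *\<^sub>v u0) $ i"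
      using that A' unfolding u0_def by (simp add: scalar_prod_right_unit)
    thus ?thesis using that unfolding ev unfolding u0_def by auto
  qed
  define B where "B = mat 1 m (\<lambda>(i,j). A' $$ (0, Suc j))"
  define D where "D = mat m m (\<lambda>(i,j). A' $$ (Suc i, Suc j))"
  define E where "E = mat 1 1 (\<lambda>_. e)"
  have BD: "B \<in> carrier_mat 1 m" "D \<in> carrier_mat m m" "E \<in> carrier_mat 1 1"
    unfolding B_def D_def E_def by auto
  have blk: "A' = four_block_mat E B (0\<^sub>m m 1) D"
    using A' col0 by (intro eq_matI) (auto simp: B_def D_def E_def)
  have "similar_mat_wit A' A (mat_adjoint U) U"
    using U' A A' by (intro similar_mat_witI[of _ _ "Suc m"]) (auto simp: A'_def)
  hence "char_poly A = char_poly A'" by (intro char_poly_similar[symmetric]) (auto simp: similar_mat_def)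
  also have "\<dots> = char_poly E * char_poly D"
    unfolding blk by (rule char_poly_four_block_zeros_col[OF BD(3,1,2)])
  also have "char_poly E = [:-e, 1:]"
    unfolding char_poly_defs E_def by (subst det_single) auto
  \<comment> \<open>Deflation: cancelling the linear factor of e leaves the characteristic
    polynomial of D, to which the induction hypothesis applies.\<close>
  finally have "[:-e, 1:] * (\<Prod>e\<leftarrow>es. [:- e, 1:]) = [:-e, 1:] * char_poly D"
    unfolding Cons.prems(2) by simp
  hence "char_poly D = (\<Prod>e\<leftarrow>es. [:- e, 1:])" by (subst (asm) mult_cancel_left) auto
  from Cons.IH[OF BD(2) this] obtain W where W: "unitary_mat m W"
    and tri: "upper_triangular (mat_adjoint W * D * W)" and diag: "diag_mat (mat_adjoint W * D * W) = es"
    by blast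
  note W' = unitary_matD[OF W]
  define V where "V = four_block_mat (1\<^sub>m 1) (0\<^sub>m 1 m) (0\<^sub>m m 1) W"
  have V: "unitary_mat (Suc m) V" unfolding V_def by (rule unitary_mat_four_block[OF W])
  note V' = unitary_matD[OF V]
  have z: "mat_adjoint (0\<^sub>m k l) = (0\<^sub>m l k :: complex mat)" for k l
    by (intro eq_matI) auto
  define T where "T = mat_adjoint W * D * W"
  have T: "T \<in> carrier_mat m m" using W' BD unfolding T_def by simp
  have "mat_adjoint V * A' * V = four_block_mat E (B * W) (0\<^sub>m m 1) T"
    unfolding V_def blk T_def using W' BD
    by (subst mat_adjoint_four_block[of _ 1 1 _ m _ m])
      (auto simp: z mult_four_block_mat[of _ 1 1 _ m _ m _ _ 1 _ m])
  moreover have "mat_adjoint (U * V) * A * (U * V) = mat_adjoint V * A' * V"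
    using U' V' A unfolding A'_def
    by (simp add: mat_adjoint_mult assoc_mult_mat[of _ "Suc m" "Suc m" _ "Suc m" _ "Suc m"])
  ultimately have eq: "mat_adjoint (U * V) * A * (U * V) = four_block_mat E (B * W) (0\<^sub>m m 1) T" by simp
  have "upper_triangular (four_block_mat E (B * W) (0\<^sub>m m 1) T)"
    by (rule upper_triangular_four_block[OF BD(3) T]) (use tri in \<open>auto simp: E_def T_def\<close>)
  moreover have "diag_mat (four_block_mat E (B * W) (0\<^sub>m m 1) T) = e # es"
    using diag_four_block_mat[OF BD(3) T] diag unfolding T_def by (simp add: E_def diag_mat_def)
  ultimately show ?case unfolding n using unitary_mat_mult[OF U V] eq by metis
qed

section \<open>Unitary diagonalisation of Hermitian matrices\<close>

lemma adjoint_conjugation: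
  assumes U: "unitary_mat n U" and A: "A \<in> carrier_mat n n"
  shows "U * (mat_adjoint U * A * U) * mat_adjoint U = A"
    and "mat_adjoint U * (U * A * mat_adjoint U) * U = A"
  using unitary_matD[OF U] A cancel_adjoint[OF U] cancel_adjoint_right[OF U]
  by (simp_all add: assoc_mult_mat[of _ n n _ n _ n])

lemma hermitian_mat_congruence:
  assumes "hermitian_mat n M" "F \<in> carrier_mat n n"
  shows "hermitian_mat n (mat_adjoint F * M * F)"
  using assms unfolding hermitian_mat_def
  by (auto simp: mat_adjoint_mult[of _ n n _ n] assoc_mult_mat[of _ n n _ n _ n])

text \<open>An abbreviation, so that the index rules for \<open>mat\<close> apply without
  unfolding.\<close>

abbreviation diagonal_of :: "nat \<Rightarrow> (nat \<Rightarrow> complex) \<Rightarrow> complex mat" where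
  "diagonal_of n d \<equiv> mat n n (\<lambda>(i, j). if i = j then d i else 0)"

lemma diagonal_of_mult:
  "X \<in> carrier_mat n m \<Longrightarrow> diagonal_of n d * X = mat n m (\<lambda>(i, j). d i * X $$ (i, j))"
  "X \<in> carrier_mat m n \<Longrightarrow> X * diagonal_of n d = mat m n (\<lambda>(i, j). X $$ (i, j) * d j)"
  by (auto intro!: eq_matI simp: scalar_prod_def if_distrib[of "\<lambda>x. _ * x"] if_distrib[of "\<lambda>x. x * _"]
      sum.delta cong: if_cong)

lemma mat_adjoint_diagonal_of [simp]: "mat_adjoint (diagonal_of n d) = diagonal_of n (\<lambda>i. cnj (d i))"
  by (intro eq_matI) auto

text \<open>A Schur form of a Hermitian matrix is both Hermitian and triangular, hence diagonal, and
  its diagonal entries equal their conjugates.\<close>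

lemma hermitian_unitary_diag:
  assumes M: "hermitian_mat n M" and cp: "char_poly M = (\<Prod>e\<leftarrow>es. [:- e, 1:])"
  obtains U where "unitary_mat n U" "mat_adjoint U * M * U = diagonal_of n (\<lambda>i. es ! i)"
    "\<And>i. i < n \<Longrightarrow> es ! i \<in> \<real>"
proof -
  have Mc: "M \<in> carrier_mat n n" using M unfolding hermitian_mat_def by simp
  obtain U where U: "unitary_mat n U" and tri: "upper_triangular (mat_adjoint U * M * U)"
    and diag: "diag_mat (mat_adjoint U * M * U) = es"
    using unitary_schur[OF Mc cp] by blast
  define T where "T = mat_adjoint U * M * U"
  have herm: "hermitian_mat n T"
    unfolding T_def using M U unitary_matD by (intro hermitian_mat_congruence) auto
  hence T: "T \<in> carrier_mat n n" and adj: "mat_adjoint T = T" unfolding hermitian_mat_def by auto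
  have cnj: "T $$ (i,j) = cnj (T $$ (j,i))" if "i < n" "j < n" for i j
    using mat_adjoint_index[of i T j] that T unfolding adj by simp
  have es: "es ! i = T $$ (i,i)" if "i < n" for i
    using that T diag unfolding T_def[symmetric] diag_mat_def by auto
  have off: "T $$ (i,j) = 0" if "i < n" "j < n" "i \<noteq> j" for i j
    using that cnj[OF that(1,2)] upper_triangularD[OF tri, folded T_def, of j i]
      upper_triangularD[OF tri, folded T_def, of i j] T by (cases "j < i") auto
  have "T = diagonal_of n (\<lambda>i. es ! i)"
    using T es off by (intro eq_matI) auto
  moreover have "es ! i \<in> \<real>" if "i < n" for i
    using cnj[OF that that] es[OF that] by (metis Reals_cnj_iff)
  ultimately show thesis using that U unfolding T_def by blast
qed

lemma eigenvalue_diagonal_of: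
  "eigenvalue (diagonal_of n d) e \<longleftrightarrow> (\<exists>i<n. d i = e)"
proof -
  have "char_poly (diagonal_of n d) = (\<Prod>a\<leftarrow>diag_mat (diagonal_of n d). [:- a, 1:])"
    by (rule char_poly_upper_triangular) auto
  thus ?thesis
    by (subst eigenvalue_root_char_poly[of _ n]) (auto simp: poly_prod_list prod_list_zero_iff diag_mat_def)
qed

lemma eigenvalue_unitary_conj:
  assumes U: "unitary_mat n U" and M: "M \<in> carrier_mat n n"
  shows "eigenvalue (mat_adjoint U * M * U) e \<longleftrightarrow> eigenvalue M e"
proof -
  note U' = unitary_matD[OF U]
  have "similar_mat_wit (mat_adjoint U * M * U) M (mat_adjoint U) U"
    using U' M by (intro similar_mat_witI[of _ _ n]) auto
  hence "char_poly (mat_adjoint U * M * U) = char_poly M"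
    by (intro char_poly_similar) (auto simp: similar_mat_def)
  moreover have "mat_adjoint U * M * U \<in> carrier_mat n n" using U' M by simp
  ultimately show ?thesis using M by (simp add: eigenvalue_root_char_poly)
qed

text \<open>The first statement on eigenvalues transfers conditions on the spectrum to d; the second
  transfers conditions on d back to the whole spectrum.\<close>

lemma hermitian_spectral:
  assumes M: "hermitian_mat n M"
  obtains U d where "unitary_mat n U" "mat_adjoint U * M * U = diagonal_of n (\<lambda>i. complex_of_real (d i))"
    "\<And>i. i < n \<Longrightarrow> eigenvalue M (complex_of_real (d i))"
    "\<And>e. eigenvalue M e \<Longrightarrow> \<exists>i<n. e = complex_of_real (d i)"
proof -
  have Mc: "M \<in> carrier_mat n n" using M unfolding hermitian_mat_def by simp
  obtain es where "char_poly M = (\<Prod>e\<leftarrow>es. [:- e, 1:])" using char_poly_factorized[OF Mc] by blast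
  then obtain U where U: "unitary_mat n U" and D: "mat_adjoint U * M * U = diagonal_of n (\<lambda>i. es ! i)"
    and r: "\<And>i. i < n \<Longrightarrow> es ! i \<in> \<real>"
    using hermitian_unitary_diag[OF M] by blast
  define d where "d = (\<lambda>i. Re (es ! i))"
  have d: "es ! i = complex_of_real (d i)" if "i < n" for i
    using r[OF that] unfolding d_def by simp
  have D': "mat_adjoint U * M * U = diagonal_of n (\<lambda>i. complex_of_real (d i))"
    unfolding D by (intro eq_matI) (auto simp: d)
  have "eigenvalue M e \<longleftrightarrow> (\<exists>i<n. complex_of_real (d i) = e)" for e
    using eigenvalue_unitary_conj[OF U Mc, of e] unfolding D' eigenvalue_diagonal_of by simp
  thus thesis using that[OF U D'] by metis
qed

section \<open>Positive semidefinite matrices\<close>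

lemma gram_diag_entry:
  fixes X :: "complex mat"
  assumes "X \<in> carrier_mat m n" "i < n"
  shows "(mat_adjoint X * X) $$ (i, i) = complex_of_real (\<Sum>k<m. (cmod (X $$ (k, i)))\<^sup>2)"
proof -
  have "(mat_adjoint X * X) $$ (i, i) = (\<Sum>k<m. cnj (X $$ (k, i)) * X $$ (k, i))"
    using assms by (simp add: scalar_prod_def lessThan_atLeast0)
  also have "\<dots> = (\<Sum>k<m. complex_of_real ((cmod (X $$ (k, i)))\<^sup>2))"
    by (intro sum.cong refl) (metis complex_norm_square mult.commute)
  finally show ?thesis by (simp only: of_real_sum)
qed

text \<open>Taking for F the unitary matrix that diagonalises M reads off the eigenvalues. This test
  replaces the quadratic form; unlike the eigenvalues, the tested entries are additive in M, which
  \<open>psd_mat_add\<close> relies on.\<close>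

lemma psd_matI:
  assumes M: "hermitian_mat n M"
    and nonneg: "\<And>F i. F \<in> carrier_mat n n \<Longrightarrow> i < n \<Longrightarrow> 0 \<le> Re ((mat_adjoint F * M * F) $$ (i, i))"
  shows "psd_mat n M"
proof -
  obtain U d where U: "unitary_mat n U"
    and D: "mat_adjoint U * M * U = diagonal_of n (\<lambda>i. complex_of_real (d i))"
    and "\<And>i. i < n \<Longrightarrow> eigenvalue M (complex_of_real (d i))"
    and ev: "\<And>e. eigenvalue M e \<Longrightarrow> \<exists>i<n. e = complex_of_real (d i)"
    by (rule hermitian_spectral[OF M]) (rule that)
  have d0: "0 \<le> d i" if "i < n" for i
  proof -
    have "0 \<le> Re ((mat_adjoint U * M * U) $$ (i, i))"
      by (rule nonneg[OF unitary_matD(1)[OF U] that])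
    thus ?thesis unfolding D using that by simp
  qed
  have "e \<in> \<real> \<and> 0 \<le> Re e" if "eigenvalue M e" for e
    using ev[OF that] d0 by auto
  thus ?thesis unfolding psd_mat_def using M by blast
qed

lemma psd_mat_gram:
  assumes G: "G \<in> carrier_mat n n"
  shows "psd_mat n (mat_adjoint G * G)"
proof (rule psd_matI)
  show "hermitian_mat n (mat_adjoint G * G)"
    using G unfolding hermitian_mat_def by (simp add: mat_adjoint_mult[of _ n n _ n])
  fix F :: "complex mat" and i assume F: "F \<in> carrier_mat n n" and i: "i < n"
  have "mat_adjoint F * (mat_adjoint G * G) * F = mat_adjoint (G * F) * (G * F)"
    using F G by (simp add: mat_adjoint_mult[of _ n n _ n] assoc_mult_mat[of _ n n _ n _ n])
  thus "0 \<le> Re ((mat_adjoint F * (mat_adjoint G * G) * F) $$ (i, i))"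
    using gram_diag_entry[of "G * F" n n i] F G i by (simp add: sum_nonneg del: index_mult_mat)
qed

text \<open>The witness is \<open>G = R * mat_adjoint U\<close>, where R is the entrywise square
  root of the diagonal matrix.\<close>

lemma unitary_conj_diagonal_gram:
  assumes U: "unitary_mat n U" and d: "\<And>i. i < n \<Longrightarrow> 0 \<le> d i"
  shows "\<exists>G\<in>carrier_mat n n. U * diagonal_of n (\<lambda>i. complex_of_real (d i)) * mat_adjoint U = mat_adjoint G * G"
proof -
  note U' = unitary_matD[OF U]
  define R where "R = diagonal_of n (\<lambda>i. complex_of_real (sqrt (d i)))"
  have R: "R \<in> carrier_mat n n" unfolding R_def by simp
  have RR: "mat_adjoint R * R = diagonal_of n (\<lambda>i. complex_of_real (d i))"
    unfolding R_def using d
    by (subst mat_adjoint_diagonal_of, subst diagonal_of_mult(1)[of _ n n])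
      (auto intro!: eq_matI simp flip: of_real_mult)
  have "mat_adjoint (R * mat_adjoint U) * (R * mat_adjoint U) = U * (mat_adjoint R * R) * mat_adjoint U"
    using R U' by (simp add: mat_adjoint_mult[of _ n n _ n] assoc_mult_mat[of _ n n _ n _ n])
  thus ?thesis unfolding RR using R U' by (intro bexI[of _ "R * mat_adjoint U"]) auto
qed

lemma psd_mat_obtain_gram:
  assumes M: "psd_mat n M"
  obtains G where "G \<in> carrier_mat n n" "M = mat_adjoint G * G"
proof -
  have herm: "hermitian_mat n M" using M unfolding psd_mat_def by simp
  hence Mc: "M \<in> carrier_mat n n" unfolding hermitian_mat_def by simp
  obtain U d where U: "unitary_mat n U"
    and D: "mat_adjoint U * M * U = diagonal_of n (\<lambda>i. complex_of_real (d i))"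
    and ev: "\<And>i. i < n \<Longrightarrow> eigenvalue M (complex_of_real (d i))"
    and "\<And>e. eigenvalue M e \<Longrightarrow> \<exists>i<n. e = complex_of_real (d i)"
    by (rule hermitian_spectral[OF herm]) (rule that)
  have d0: "0 \<le> d i" if "i < n" for i
    using M ev[OF that] unfolding psd_mat_def by auto
  have MU: "M = U * diagonal_of n (\<lambda>i. complex_of_real (d i)) * mat_adjoint U"
    unfolding D[symmetric] by (rule adjoint_conjugation(1)[OF U Mc, symmetric])
  have "\<exists>G\<in>carrier_mat n n. M = mat_adjoint G * G"
    unfolding MU by (rule unitary_conj_diagonal_gram[OF U]) (rule d0)
  thus thesis by (elim bexE) (rule that)
qed

lemma psd_mat_carrier: "psd_mat n M \<Longrightarrow> M \<in> carrier_mat n n"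
  unfolding psd_mat_def hermitian_mat_def by simp

text \<open>Converse of \<open>psd_matI\<close>: writing M as a Gram matrix turns the entry into the
  squared norm of a column of \<open>G * F\<close>.\<close>

lemma psd_mat_form_nonneg:
  assumes M: "psd_mat n M" and F: "F \<in> carrier_mat n n" and i: "i < n"
  shows "0 \<le> Re ((mat_adjoint F * M * F) $$ (i, i))"
proof -
  obtain G where G: "G \<in> carrier_mat n n" "M = mat_adjoint G * G"
    using psd_mat_obtain_gram[OF M] by blast
  have "mat_adjoint F * M * F = mat_adjoint (G * F) * (G * F)"
    using F G by (simp add: mat_adjoint_mult[of _ n n _ n] assoc_mult_mat[of _ n n _ n _ n])
  thus ?thesis
    using gram_diag_entry[of "G * F" n n i] F G i by (simp add: sum_nonneg del: index_mult_mat)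
qed

lemma psd_mat_add:
  assumes "psd_mat n M" "psd_mat n D"
  shows "psd_mat n (M + D)"
proof (rule psd_matI)
  note c = psd_mat_carrier[OF assms(1)] psd_mat_carrier[OF assms(2)]
  show "hermitian_mat n (M + D)"
    using assms c unfolding psd_mat_def hermitian_mat_def by (simp add: mat_adjoint_add[of _ n n])
  fix F :: "complex mat" and i assume F: "F \<in> carrier_mat n n" and i: "i < n"
  have "mat_adjoint F * (M + D) * F = mat_adjoint F * M * F + mat_adjoint F * D * F"
    using F c by (simp add: mult_add_distrib_mat[of _ n n _ n] add_mult_distrib_mat[of _ n n _ _ n])
  moreover have "mat_adjoint F * D * F \<in> carrier_mat n n" using F c by simp
  ultimately have "(mat_adjoint F * (M + D) * F) $$ (i,i)
      = (mat_adjoint F * M * F) $$ (i,i) + (mat_adjoint F * D * F) $$ (i,i)"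
    using i by (simp del: index_mult_mat add: carrier_matD)
  thus "0 \<le> Re ((mat_adjoint F * (M + D) * F) $$ (i, i))"
    using psd_mat_form_nonneg[OF assms(1) F i] psd_mat_form_nonneg[OF assms(2) F i] by simp
qed

text \<open>Two evaluations of one block determinant over the polynomial ring. Multiplying M by P on
  the left clears the upper right block and yields the characteristic polynomial of
  \<open>A * B\<close>; multiplying by R clears the lower left block and yields that of
  \<open>B * A\<close>, with a factor \<open>det X\<close> on both sides.\<close>

lemma char_poly_mult_commute:
  fixes A B :: "'a :: idom mat"
  assumes A: "A \<in> carrier_mat n n" and B: "B \<in> carrier_mat n n"
  shows "char_poly (A * B) = char_poly (B * A)"
proof -
  let ?h = "\<lambda>a :: 'a. [:a:]"
  define A' where "A' = map_mat ?h A"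
  define B' where "B' = map_mat ?h B"
  define X where "X = [:0, 1:] \<cdot>\<^sub>m (1\<^sub>m n :: 'a poly mat)"
  have c: "A' \<in> carrier_mat n n" "B' \<in> carrier_mat n n" "X \<in> carrier_mat n n"
    using A B unfolding A'_def B'_def X_def by auto
  interpret h: comm_ring_hom ?h by (standard; simp)
  have hm: "map_mat ?h (C * D) = map_mat ?h C * map_mat ?h D"
    if "C \<in> carrier_mat n n" "D \<in> carrier_mat n n" for C D
    by (rule h.mat_hom_mult[OF that])
  have cp: "char_poly_matrix (C * D) = X - map_mat ?h C * map_mat ?h D"
    if "C \<in> carrier_mat n n" "D \<in> carrier_mat n n" for C D
    unfolding char_poly_matrix_def hm[OF that, symmetric] X_def using that
    by (intro eq_matI) auto
  have cc: "X - A' * B' \<in> carrier_mat n n" "X - B' * A' \<in> carrier_mat n n"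
    using c by (auto intro!: minus_carrier_mat)
  define M where "M = four_block_mat X A' B' (1\<^sub>m n)"
  define P where "P = four_block_mat (1\<^sub>m n) (- A') (0\<^sub>m n n) (1\<^sub>m n)"
  define R where "R = four_block_mat (1\<^sub>m n) (0\<^sub>m n n) (- B') X"
  have M: "M \<in> carrier_mat (n + n) (n + n)" "P \<in> carrier_mat (n + n) (n + n)"
    "R \<in> carrier_mat (n + n) (n + n)"
    unfolding M_def P_def R_def using c by auto
  have "P * M = four_block_mat (X - A' * B') (0\<^sub>m n n) B' (1\<^sub>m n)"
  proof -
    have "P * M = four_block_mat (1\<^sub>m n * X + - A' * B') (1\<^sub>m n * A' + - A' * 1\<^sub>m n)
        (0\<^sub>m n n * X + 1\<^sub>m n * B') (0\<^sub>m n n * A' + 1\<^sub>m n * 1\<^sub>m n)"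
      unfolding P_def M_def using c by (intro mult_four_block_mat) auto
    moreover have "1\<^sub>m n * X + - A' * B' = X - A' * B'" "1\<^sub>m n * A' + - A' * 1\<^sub>m n = 0\<^sub>m n n"
      "0\<^sub>m n n * X + 1\<^sub>m n * B' = B'" "0\<^sub>m n n * A' + 1\<^sub>m n * 1\<^sub>m n = (1\<^sub>m n :: 'a poly mat)"
      using c by (auto intro!: eq_matI)
    ultimately show ?thesis by (simp only:)
  qed
  hence "det (P * M) = det (X - A' * B')"
    using c cc det_four_block_mat_upper_right_zero[of "X - A' * B'" n "0\<^sub>m n n" n B' "1\<^sub>m n"]
    by simp
  moreover have "det P = 1"
    unfolding P_def using c by (subst det_four_block_mat_lower_left_zero[of _ n _ n]) auto
  ultimately have 1: "det M = char_poly (A * B)"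
    unfolding det_mult[OF M(2,1)] char_poly_def cp[OF A B] A'_def[symmetric] B'_def[symmetric] by simp
  have "R * M = four_block_mat X A' (0\<^sub>m n n) (X - B' * A')"
  proof -
    \<comment> \<open>The scalar matrix X commutes with B'; this is what clears the lower left
      block.\<close>
    have "X * B' = B' * X"
      unfolding X_def using c
      by (subst mult_smult_assoc_mat[of _ n n _ n], simp, simp,
          subst mult_smult_distrib[of _ n n _ n]) auto
    hence "- B' * X + X * B' = 0\<^sub>m n n" "- B' * A' + X * 1\<^sub>m n = X - B' * A'"
      using c by (auto intro!: eq_matI simp: uminus_mult_left_mat simp del: index_mult_mat(1))
    moreover have "1\<^sub>m n * X + 0\<^sub>m n n * B' = X" "1\<^sub>m n * A' + 0\<^sub>m n n * 1\<^sub>m n = A'"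
      using c by auto
    moreover have "R * M = four_block_mat (1\<^sub>m n * X + 0\<^sub>m n n * B') (1\<^sub>m n * A' + 0\<^sub>m n n * 1\<^sub>m n)
        (- B' * X + X * B') (- B' * A' + X * 1\<^sub>m n)"
      unfolding R_def M_def using c by (intro mult_four_block_mat) auto
    ultimately show ?thesis by (simp only:)
  qed
  hence "det (R * M) = det X * det (X - B' * A')"
    using c cc det_four_block_mat_lower_left_zero[of X n A' n "0\<^sub>m n n" "X - B' * A'"]
    by simp
  moreover have "det R = det X"
    unfolding R_def using c by (subst det_four_block_mat_upper_right_zero[of _ n _ n]) auto
  ultimately have "det X * det M = det X * char_poly (B * A)"
    unfolding det_mult[OF M(3,1)] char_poly_def cp[OF B A] A'_def[symmetric] B'_def[symmetric] by simp
  \<comment> \<open>\<open>det X\<close> is the n-th power of the indeterminate, so it cancels even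
    when A and B are singular.\<close>
  moreover have "det X \<noteq> 0" unfolding X_def by (simp add: det_smult)
  ultimately show ?thesis using 1 by simp
qed

section \<open>Unitarily invariant norms\<close>

context
  fixes n :: nat and N :: "complex mat \<Rightarrow> real"
  assumes N: "unitarily_invariant_norm n N"
begin

lemma uin_nonneg: "X \<in> carrier_mat n n \<Longrightarrow> 0 \<le> N X"
  and uin_smult: "X \<in> carrier_mat n n \<Longrightarrow> N (c \<cdot>\<^sub>m X) = cmod c * N X"
  and uin_triangle: "X \<in> carrier_mat n n \<Longrightarrow> Y \<in> carrier_mat n n \<Longrightarrow> N (X + Y) \<le> N X + N Y"
  and uin_eq_0: "X \<in> carrier_mat n n \<Longrightarrow> N X = 0 \<longleftrightarrow> X = 0\<^sub>m n n"
  using N unfolding unitarily_invariant_norm_def matrix_norm_on_def by auto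

lemma uin_unitary:
  "X \<in> carrier_mat n n \<Longrightarrow> unitary_mat n U \<Longrightarrow> unitary_mat n V \<Longrightarrow> N (U * X * V) = N X"
  using N unfolding unitarily_invariant_norm_def by auto

lemma uin_unitary_left: "X \<in> carrier_mat n n \<Longrightarrow> unitary_mat n U \<Longrightarrow> N (U * X) = N X"
  using uin_unitary[of X U "1\<^sub>m n"] unitary_matD(1)[of n U] by simp

lemma uin_conj:
  "X \<in> carrier_mat n n \<Longrightarrow> unitary_mat n U \<Longrightarrow> N (mat_adjoint U * X * U) = N X"
  using uin_unitary[of X "mat_adjoint U" U] unitary_mat_adjoint[of n U] by simp

section \<open>Averages over sign changes: scaling, monotonicity and pinching\<close>

lemma unitary_mat_sign: "unitary_mat n (diagonal_of n (\<lambda>i. if P i then - 1 else 1))"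
  unfolding unitary_mat_def
  by (subst mat_adjoint_diagonal_of, subst diagonal_of_mult(1)[of _ n n]) (auto intro!: eq_matI)

text \<open>The weights are parametrised so that an entry where Y is the negative of X is multiplied
  by r, while an entry where they agree is unchanged; r = 0 is the plain average.\<close>

lemma uin_convex:
  assumes "X \<in> carrier_mat n n" "Y \<in> carrier_mat n n" "N X \<le> c" "N Y \<le> c" "-1 \<le> r" "r \<le> 1"
  shows "N (complex_of_real ((1 + r) / 2) \<cdot>\<^sub>m X + complex_of_real ((1 - r) / 2) \<cdot>\<^sub>m Y) \<le> c"
proof -
  have "N (complex_of_real ((1 + r) / 2) \<cdot>\<^sub>m X + complex_of_real ((1 - r) / 2) \<cdot>\<^sub>m Y)
     \<le> (1 + r) / 2 * N X + (1 - r) / 2 * N Y"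
    using uin_triangle[of "complex_of_real ((1 + r) / 2) \<cdot>\<^sub>m X" "complex_of_real ((1 - r) / 2) \<cdot>\<^sub>m Y"]
      assms(1,2,5,6) by (simp add: uin_smult del: of_real_add of_real_diff of_real_divide)
  also have "\<dots> \<le> (1 + r) / 2 * c + (1 - r) / 2 * c"
    using assms(3-6) by (intro add_mono mult_left_mono) auto
  also have "\<dots> = c" by (simp add: field_simps)
  finally show ?thesis .
qed

text \<open>Negating row k is multiplication by a unitary matrix and keeps the norm; a weighted
  average with X then scales that row by r.\<close>

lemma uin_scale_row:
  assumes X: "X \<in> carrier_mat n n" and r: "-1 \<le> r" "r \<le> 1"
  shows "N (mat n n (\<lambda>(i,j). if i = k then complex_of_real r * X $$ (i,j) else X $$ (i,j))) \<le> N X"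
    (is "N ?Y \<le> _")
proof -
  define D where "D = diagonal_of n (\<lambda>i. if i = k then - 1 else 1)"
  have D: "unitary_mat n D" unfolding D_def by (rule unitary_mat_sign)
  have DX: "D * X = mat n n (\<lambda>(i,j). (if i = k then - 1 else 1) * X $$ (i,j))"
    unfolding D_def using X by (rule diagonal_of_mult)
  have "?Y = complex_of_real ((1 + r) / 2) \<cdot>\<^sub>m X + complex_of_real ((1 - r) / 2) \<cdot>\<^sub>m (D * X)"
    unfolding DX using X by (intro eq_matI) (auto simp: field_simps)
  thus ?thesis
    using uin_convex[of X "D * X" "N X" r] X r D uin_unitary_left[of X D] unitary_matD(1)[OF D] by simp
qed

text \<open>One diagonal entry is lowered at a time: \<open>E k\<close> carries s in the first k
  places and t in the others.\<close>

lemma uin_diagonal_mono: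
  assumes "\<And>i. i < n \<Longrightarrow> 0 \<le> s i \<and> s i \<le> t i"
  shows "N (diagonal_of n (\<lambda>i. complex_of_real (s i))) \<le> N (diagonal_of n (\<lambda>i. complex_of_real (t i)))"
proof -
  define E where "E k = diagonal_of n (\<lambda>i. complex_of_real (if i < k then s i else t i))" for k
  have "N (E k) \<le> N (E 0)" if "k \<le> n" for k
    using that
  proof (induction k)
    case (Suc k)
    \<comment> \<open>If t k = 0 then s k = 0 as well, and the value 0 keeps the equation s k = r *
      t k.\<close>
    define r where "r = (if t k = 0 then 0 else s k / t k)"
    have st: "0 \<le> s k" "s k \<le> t k" using assms[of k] Suc.prems by auto
    have r: "-1 \<le> r" "r \<le> 1" "s k = r * t k"
    proof -
      have "0 \<le> r" using st unfolding r_def by simp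
      thus "-1 \<le> r" by simp
      show "r \<le> 1" "s k = r * t k" using st unfolding r_def by (auto simp: divide_le_eq)
    qed
    have "E (Suc k) = mat n n (\<lambda>(i,j). if i = k then complex_of_real r * E k $$ (i,j) else E k $$ (i,j))"
      using r(3) unfolding E_def by (intro eq_matI) auto
    moreover have "E k \<in> carrier_mat n n" unfolding E_def by simp
    ultimately have "N (E (Suc k)) \<le> N (E k)" using uin_scale_row[of "E k" r k] r by simp
    thus ?case using Suc by simp
  qed simp
  moreover have "E n = diagonal_of n (\<lambda>i. complex_of_real (s i))"
    unfolding E_def by (intro eq_matI) auto
  moreover have "E 0 = diagonal_of n (\<lambda>i. complex_of_real (t i))"
    unfolding E_def by (intro eq_matI) auto
  ultimately show ?thesis by (metis order_refl)
qed

text \<open>Off-diagonal entries are removed one row and column at a time: \<open>E (Suc k)\<close>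
  is the average of \<open>E k\<close> and its conjugate by the sign change in coordinate k. The
  entry (k, k) is negated twice and survives.\<close>

lemma uin_pinching:
  assumes X: "X \<in> carrier_mat n n"
  shows "N (diagonal_of n (\<lambda>i. X $$ (i,i))) \<le> N X"
proof -
  define E where "E k = mat n n (\<lambda>(i,j). if i \<noteq> j \<and> (i < k \<or> j < k) then 0 else X $$ (i,j))" for k
  have Ec: "E k \<in> carrier_mat n n" for k unfolding E_def by simp
  have le: "N (E k) \<le> N (E 0)" for k
  proof (induction k)
    case (Suc k)
    define D where "D = diagonal_of n (\<lambda>i. if i = k then - 1 else 1)"
    have D: "unitary_mat n D" unfolding D_def by (rule unitary_mat_sign)
    have DED: "D * E k * D = mat n n (\<lambda>(i,j). (if i = k then - 1 else 1) * E k $$ (i,j) * (if j = k then - 1 else 1))"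
      unfolding D_def
      by (subst diagonal_of_mult(1)[OF Ec], subst diagonal_of_mult(2)[of _ n n]) (auto intro!: eq_matI)
    have "E (Suc k) = complex_of_real ((1 + 0) / 2) \<cdot>\<^sub>m E k + complex_of_real ((1 - 0) / 2) \<cdot>\<^sub>m (D * E k * D)"
      unfolding DED by (intro eq_matI) (auto simp: E_def)
    hence "N (E (Suc k)) \<le> N (E k)"
      using uin_convex[of "E k" "D * E k * D" "N (E k)" 0] D uin_unitary[OF Ec D D] Ec unitary_matD(1)[OF D]
      by simp
    thus ?case using Suc by simp
  qed simp
  have "E n = diagonal_of n (\<lambda>i. X $$ (i,i))" "E 0 = X"
    using X unfolding E_def by (auto intro!: eq_matI)
  thus ?thesis using le[of n] by simp
qed

text \<open>In an eigenbasis of A the diagonal of A + D dominates that of A entrywise, and by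
  pinching this diagonal has at most the norm of A + D.\<close>

lemma uin_psd_mono:
  assumes A: "psd_mat n A" and D: "psd_mat n D"
  shows "N A \<le> N (A + D)"
proof -
  note c = psd_mat_carrier[OF A] psd_mat_carrier[OF D]
  have herm: "hermitian_mat n A" using A unfolding psd_mat_def by simp
  obtain U d where U: "unitary_mat n U"
    and dA: "mat_adjoint U * A * U = diagonal_of n (\<lambda>i. complex_of_real (d i))"
    and ev: "\<And>i. i < n \<Longrightarrow> eigenvalue A (complex_of_real (d i))"
    and "\<And>e. eigenvalue A e \<Longrightarrow> \<exists>i<n. e = complex_of_real (d i)"
    by (rule hermitian_spectral[OF herm]) (rule that)
  note U' = unitary_matD[OF U]
  define D' where "D' = mat_adjoint U * D * U"
  have D'c: "D' \<in> carrier_mat n n" using U' c unfolding D'_def by simp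
  have D'0: "0 \<le> Re (D' $$ (i,i))" if "i < n" for i
    unfolding D'_def by (rule psd_mat_form_nonneg[OF D U'(1) that])
  have D'real: "complex_of_real (Re (D' $$ (i,i))) = D' $$ (i,i)" if "i < n" for i
  proof -
    have "hermitian_mat n D'"
      using hermitian_mat_congruence[OF _ U'(1), of D] D unfolding psd_mat_def D'_def by simp
    hence "D' $$ (i,i) = cnj (D' $$ (i,i))"
      using mat_adjoint_index[of i D' i] that D'c unfolding hermitian_mat_def by simp
    thus ?thesis by (metis Reals_cnj_iff of_real_Re)
  qed
  have d0: "0 \<le> d i" if "i < n" for i using A ev[OF that] unfolding psd_mat_def by auto
  have S: "mat_adjoint U * (A + D) * U = mat_adjoint U * A * U + D'"
    unfolding D'_def using U' c
    by (simp add: mult_add_distrib_mat[of _ n n _ n] add_mult_distrib_mat[of _ n n _ _ n])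
  have "N A = N (diagonal_of n (\<lambda>i. complex_of_real (d i)))"
    using uin_conj[OF c(1) U] unfolding dA by simp
  also have "\<dots> \<le> N (diagonal_of n (\<lambda>i. complex_of_real (d i + Re (D' $$ (i,i)))))"
    using d0 D'0 by (intro uin_diagonal_mono) auto
  also have "diagonal_of n (\<lambda>i. complex_of_real (d i + Re (D' $$ (i,i))))
      = diagonal_of n (\<lambda>i. (mat_adjoint U * (A + D) * U) $$ (i,i))"
    unfolding S dA using D'c D'real by (intro eq_matI) auto
  also have "N \<dots> \<le> N (mat_adjoint U * (A + D) * U)"
    using U' c by (intro uin_pinching) simp
  also have "\<dots> = N (A + D)" using c U by (intro uin_conj) auto
  finally show ?thesis .
qed

text \<open>Up to unitary conjugation, M is the diagonal matrix of the common list \<open>es\<close>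
  of eigenvalues, which is also the diagonal of a Schur form of X; pinching compares the
  two.\<close>

lemma uin_hermitian_le:
  assumes M: "hermitian_mat n M" and X: "X \<in> carrier_mat n n" and cp: "char_poly M = char_poly X"
  shows "N M \<le> N X"
proof -
  have Mc: "M \<in> carrier_mat n n" using M unfolding hermitian_mat_def by simp
  obtain es where es: "char_poly X = (\<Prod>e\<leftarrow>es. [:- e, 1:])" using char_poly_factorized[OF X] by blast
  obtain U where U: "unitary_mat n U" and D: "mat_adjoint U * M * U = diagonal_of n (\<lambda>i. es ! i)"
    and "\<And>i. i < n \<Longrightarrow> es ! i \<in> \<real>"
    by (rule hermitian_unitary_diag[OF M trans[OF cp es]]) (rule that)
  obtain V where V: "unitary_mat n V" and diag: "diag_mat (mat_adjoint V * X * V) = es"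
    using unitary_schur[OF X es] by (elim exE conjE)
  have T: "mat_adjoint V * X * V \<in> carrier_mat n n" using X unitary_matD(1)[OF V] by simp
  have "diagonal_of n (\<lambda>i. es ! i) = diagonal_of n (\<lambda>i. (mat_adjoint V * X * V) $$ (i,i))"
    using T unfolding diag[symmetric] diag_mat_def by (intro eq_matI) auto
  hence "N M = N (diagonal_of n (\<lambda>i. (mat_adjoint V * X * V) $$ (i,i)))"
    using uin_conj[OF Mc U] unfolding D by simp
  also have "\<dots> \<le> N (mat_adjoint V * X * V)" by (rule uin_pinching[OF T])
  also have "\<dots> = N X" by (rule uin_conj[OF X V])
  finally show ?thesis .
qed

text \<open>Both products are Hermitian with one characteristic polynomial, so
  \<open>uin_hermitian_le\<close> applies in both directions.\<close>

lemma uin_gram_commute: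
  assumes G: "G \<in> carrier_mat n n"
  shows "N (mat_adjoint G * G) = N (G * mat_adjoint G)"
proof (rule antisym)
  have cp: "char_poly (mat_adjoint G * G) = char_poly (G * mat_adjoint G)"
    using G by (intro char_poly_mult_commute) auto
  have h: "hermitian_mat n (mat_adjoint G * G)" "hermitian_mat n (G * mat_adjoint G)"
    using G unfolding hermitian_mat_def by (simp_all add: mat_adjoint_mult[of _ n n _ n])
  have c: "mat_adjoint G * G \<in> carrier_mat n n" "G * mat_adjoint G \<in> carrier_mat n n"
    using G by auto
  show "N (mat_adjoint G * G) \<le> N (G * mat_adjoint G)"
    by (rule uin_hermitian_le[OF h(1) c(2) cp])
  show "N (G * mat_adjoint G) \<le> N (mat_adjoint G * G)"
    by (rule uin_hermitian_le[OF h(2) c(1) cp[symmetric]])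
qed

end

section \<open>Polar decomposition\<close>

text \<open>Induction on the number of zero columns of \<open>R\<close>: such a column is replaced by a nonzero vector in
  the kernel of \<open>R\<^sup>*\<close>, which keeps the columns orthogonal.\<close>

lemma orthogonal_columns_factorization:
  fixes R :: "complex mat"
  assumes "R \<in> carrier_mat n n"
    and "\<And>i j. i < n \<Longrightarrow> j < n \<Longrightarrow> i \<noteq> j \<Longrightarrow> (mat_adjoint R * R) $$ (i, j) = 0"
  shows "\<exists>W d. unitary_mat n W \<and> (\<forall>i. 0 \<le> d i) \<and> R = W * diagonal_of n (\<lambda>i. complex_of_real (d i))"
  using assms
proof (induction "card {i. i < n \<and> (mat_adjoint R * R) $$ (i, i) = 0}" arbitrary: R rule: less_induct)
  case (less R)
  note R = less.prems(1)
  define c where "c i = (\<Sum>l<n. (cmod (R $$ (l, i)))\<^sup>2)" for i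
  have c: "(mat_adjoint R * R) $$ (i, i) = complex_of_real (c i)" if "i < n" for i
    using gram_diag_entry[OF R that] unfolding c_def .
  have c_nonneg: "0 \<le> c i" for i unfolding c_def by (intro sum_nonneg) auto
  show ?case
  proof (cases "\<exists>k<n. c k = 0")
    case False
    \<comment> \<open>No column is zero here and the columns are orthogonal, so normalising them
      gives a unitary matrix.\<close>
    define e where "e i = complex_of_real (1 / sqrt (c i))" for i
    define W where "W = R * diagonal_of n e"
    have W: "W = mat n n (\<lambda>(i,j). R $$ (i,j) * e j)"
      unfolding W_def by (rule diagonal_of_mult(2)[OF R])
    have "mat_adjoint W * W = 1\<^sub>m n"
    proof (rule eq_matI)
      fix i j assume "i < dim_row (1\<^sub>m n)" "j < dim_col (1\<^sub>m n :: complex mat)"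
      hence ij: "i < n" "j < n" by auto
      have "(mat_adjoint W * W) $$ (i,j) = (\<Sum>l<n. e i * (cnj (R $$ (l,i)) * R $$ (l,j)) * e j)"
        using ij unfolding W by (simp add: scalar_prod_def lessThan_atLeast0 e_def mult_ac)
      also have "\<dots> = e i * (mat_adjoint R * R) $$ (i,j) * e j"
        using ij R by (simp add: scalar_prod_def lessThan_atLeast0 sum_distrib_left sum_distrib_right)
      also have "\<dots> = (if i = j then 1 else 0)"
      proof (cases "i = j")
        case True
        have "sqrt (c i) * sqrt (c i) = c i" "c i \<noteq> 0" using c_nonneg False ij by auto
        hence "e i * complex_of_real (c i) * e i = 1"
          unfolding e_def by (simp flip: of_real_mult add: field_simps)
        thus ?thesis using True c[OF ij(1)] by simp
      qed (use less.prems(2) ij in simp)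
      finally show "(mat_adjoint W * W) $$ (i,j) = 1\<^sub>m n $$ (i,j)" using ij by simp
    qed (auto simp: W)
    hence "unitary_mat n W" unfolding unitary_mat_def by (simp add: W)
    moreover have "R = W * diagonal_of n (\<lambda>i. complex_of_real (sqrt (c i)))"
    proof -
      have "W * diagonal_of n (\<lambda>i. complex_of_real (sqrt (c i)))
          = mat n n (\<lambda>(i,j). W $$ (i,j) * complex_of_real (sqrt (c j)))"
        by (rule diagonal_of_mult(2)) (simp add: W)
      also have "\<dots> = R" unfolding W
        using R False by (intro eq_matI) (auto simp: e_def)
      finally show ?thesis ..
    qed
    ultimately show ?thesis using c_nonneg by (intro exI[of _ W] exI[of _ "\<lambda>i. sqrt (c i)"]) auto
  next
    case True
    then obtain k where k: "k < n" "c k = 0" by blast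
    have Rk: "R $$ (l, k) = 0" if "l < n" for l
    proof -
      have "(\<Sum>l<n. (cmod (R $$ (l, k)))\<^sup>2) = 0" using k(2) unfolding c_def .
      thus ?thesis using that by (simp add: sum_nonneg_eq_0_iff)
    qed
    \<comment> \<open>T is the entrywise conjugate of R, so its column k vanishes as well. Its
      determinant is that of \<open>mat_adjoint R\<close>, which therefore has a nonzero kernel
      vector.\<close>
    define T where "T = transpose_mat (mat_adjoint R)"
    have T: "T \<in> carrier_mat n n" using R unfolding T_def by simp
    have "T *\<^sub>v unit_vec n k = 0\<^sub>v n"
      using R Rk k by (intro eq_vecI) (auto simp: T_def scalar_prod_right_unit)
    moreover have "unit_vec n k \<noteq> (0\<^sub>v n :: complex vec)"
      using k by (metis index_unit_vec(1) index_zero_vec(1) zero_neq_one)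
    ultimately have "det T = 0"
      by (subst det_0_iff_vec_prod_zero[OF T]) (intro exI[of _ "unit_vec n k"], simp)
    hence "det (mat_adjoint R) = 0"
      unfolding T_def using R by (subst (asm) det_transpose[of _ n]) auto
    then obtain v where v: "v \<in> carrier_vec n" "v \<noteq> 0\<^sub>v n" "mat_adjoint R *\<^sub>v v = 0\<^sub>v n"
      using det_0_iff_vec_prod_zero[of "mat_adjoint R" n] R by auto
    define R' where "R' = mat n n (\<lambda>(i,j). if j = k then v $ i else R $$ (i,j))"
    have R': "R' \<in> carrier_mat n n" unfolding R'_def by simp
    have entry: "(mat_adjoint R' * R') $$ (i,j) = (\<Sum>l<n. cnj (R' $$ (l,i)) * R' $$ (l,j))"
      if "i < n" "j < n" for i j
      using that R' by (simp add: scalar_prod_def lessThan_atLeast0)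
    have entryR: "(mat_adjoint R * R) $$ (i,j) = (\<Sum>l<n. cnj (R $$ (l,i)) * R $$ (l,j))"
      if "i < n" "j < n" for i j
      using that R by (simp add: scalar_prod_def lessThan_atLeast0)
    have orth: "(\<Sum>l<n. cnj (R $$ (l,i)) * v $ l) = 0" if "i < n" for i
    proof -
      have "(mat_adjoint R *\<^sub>v v) $ i = (\<Sum>l<n. cnj (R $$ (l,i)) * v $ l)"
        using that R v(1) by (simp add: scalar_prod_def lessThan_atLeast0)
      thus ?thesis using that v(3) by simp
    qed
    have orth': "(\<Sum>l<n. cnj (v $ l) * R $$ (l,i)) = 0" if "i < n" for i
    proof -
      have "(\<Sum>l<n. cnj (v $ l) * R $$ (l,i)) = cnj (\<Sum>l<n. cnj (R $$ (l,i)) * v $ l)"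
        by (simp add: mult.commute)
      thus ?thesis using orth[OF that] by simp
    qed
    have keep: "(mat_adjoint R' * R') $$ (i,j) = (mat_adjoint R * R) $$ (i,j)"
      if "i < n" "j < n" "i \<noteq> k" "j \<noteq> k" for i j
      unfolding entry[OF that(1,2)] entryR[OF that(1,2)]
      using that by (intro sum.cong) (auto simp: R'_def)
    have off: "(mat_adjoint R' * R') $$ (i,j) = 0" if "i < n" "j < n" "i \<noteq> j" for i j
    proof -
      consider "i = k" | "j = k" | "i \<noteq> k" "j \<noteq> k" by blast
      thus ?thesis
      proof cases
        case 1
        hence "(mat_adjoint R' * R') $$ (i,j) = (\<Sum>l<n. cnj (v $ l) * R $$ (l,j))"
          unfolding entry[OF that(1,2)] using that by (intro sum.cong) (auto simp: R'_def)
        thus ?thesis using orth'[OF that(2)] by simp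
      next
        case 2
        hence "(mat_adjoint R' * R') $$ (i,j) = (\<Sum>l<n. cnj (R $$ (l,i)) * v $ l)"
          unfolding entry[OF that(1,2)] using that by (intro sum.cong) (auto simp: R'_def)
        thus ?thesis using orth[OF that(1)] by simp
      next
        case 3
        thus ?thesis using keep less.prems(2) that by simp
      qed
    qed
    have kk: "(mat_adjoint R' * R') $$ (k,k) \<noteq> 0"
    proof
      assume "(mat_adjoint R' * R') $$ (k,k) = 0"
      hence "(\<Sum>l<n. (cmod (R' $$ (l, k)))\<^sup>2) = 0"
        using gram_diag_entry[OF R' k(1)] by (metis of_real_eq_0_iff)
      hence "v $ l = 0" if "l < n" for l
        using that k by (auto simp: sum_nonneg_eq_0_iff R'_def)
      hence "v = 0\<^sub>v n" using v(1) by (intro eq_vecI) auto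
      thus False using v(2) by simp
    qed
    \<comment> \<open>Only column k has changed and it is now nonzero, so the number of zero columns
      drops.\<close>
    have "card {i. i < n \<and> (mat_adjoint R' * R') $$ (i, i) = 0}
        < card {i. i < n \<and> (mat_adjoint R * R) $$ (i, i) = 0}"
    proof (rule psubset_card_mono)
      have sub: "i \<noteq> k \<and> (mat_adjoint R * R) $$ (i, i) = 0"
        if "i < n" "(mat_adjoint R' * R') $$ (i, i) = 0" for i
        using that kk keep[of i i] by metis
      have "(mat_adjoint R * R) $$ (k, k) = 0" using c[OF k(1)] k(2) by simp
      thus "{i. i < n \<and> (mat_adjoint R' * R') $$ (i, i) = 0} \<subset> {i. i < n \<and> (mat_adjoint R * R) $$ (i, i) = 0}"
        using sub k(1) kk by blast
    qed simp
    from less.hyps[OF this R' off] obtain W d where W: "unitary_mat n W" "\<And>i. 0 \<le> d i"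
      and R'W: "R' = W * diagonal_of n (\<lambda>i. complex_of_real (d i))" by blast
    have Wc: "W \<in> carrier_mat n n" by (rule unitary_matD(1)[OF W(1)])
    \<comment> \<open>The unitary factor stays the same; a zero in place k of the diagonal restores
      the zero column.\<close>
    have "R = W * diagonal_of n (\<lambda>i. complex_of_real (if i = k then 0 else d i))"
    proof (rule eq_matI)
      fix i j assume ij: "i < dim_row (W * diagonal_of n (\<lambda>i. complex_of_real (if i = k then 0 else d i)))"
        "j < dim_col (W * diagonal_of n (\<lambda>i. complex_of_real (if i = k then 0 else d i)))"
      hence ij': "i < n" "j < n" using Wc by auto
      have "R' $$ (i,j) = W $$ (i,j) * complex_of_real (d j)"
        unfolding R'W diagonal_of_mult(2)[OF Wc] using ij' by simp
      thus "R $$ (i,j) = (W * diagonal_of n (\<lambda>i. complex_of_real (if i = k then 0 else d i))) $$ (i,j)"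
        unfolding diagonal_of_mult(2)[OF Wc] using ij' Rk by (auto simp: R'_def)
    qed (use R Wc in auto)
    thus ?thesis using W
      by (intro exI[of _ W] exI[of _ "\<lambda>i. if i = k then 0 else d i"]) auto
  qed
qed

lemma psd_mat_unitary_conj_diagonal:
  assumes "unitary_mat n U" "\<And>i. i < n \<Longrightarrow> 0 \<le> d i"
  shows "psd_mat n (U * diagonal_of n (\<lambda>i. complex_of_real (d i)) * mat_adjoint U)" (is "psd_mat n ?M")
proof -
  have "\<exists>G\<in>carrier_mat n n. ?M = mat_adjoint G * G"
    by (rule unitary_conj_diagonal_gram[OF assms])
  then obtain G where G: "G \<in> carrier_mat n n" and M: "?M = mat_adjoint G * G" by (elim bexE)
  show ?thesis unfolding M by (rule psd_mat_gram[OF G])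
qed

text \<open>If V diagonalises \<open>mat_adjoint T * T\<close>, the columns of \<open>T * V\<close>
  are orthogonal, so \<open>T * V = W * D\<close> with W unitary and D nonnegative diagonal. Then
  \<open>V * mat_adjoint W * T = V * D * mat_adjoint V\<close>.\<close>

lemma polar_psd:
  assumes T: "T \<in> carrier_mat n n"
  shows "\<exists>U. unitary_mat n U \<and> psd_mat n (U * T)"
proof -
  have herm: "hermitian_mat n (mat_adjoint T * T)"
    using psd_mat_gram[OF T] unfolding psd_mat_def by simp
  obtain V e where V: "unitary_mat n V"
    and VD: "mat_adjoint V * (mat_adjoint T * T) * V = diagonal_of n (\<lambda>i. complex_of_real (e i))"
    and "\<And>i. i < n \<Longrightarrow> eigenvalue (mat_adjoint T * T) (complex_of_real (e i))"
    and "\<And>z. eigenvalue (mat_adjoint T * T) z \<Longrightarrow> \<exists>i<n. z = complex_of_real (e i)"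
    by (rule hermitian_spectral[OF herm]) (rule that)
  note V' = unitary_matD[OF V]
  have "mat_adjoint (T * V) * (T * V) = diagonal_of n (\<lambda>i. complex_of_real (e i))"
    unfolding VD[symmetric] using T V'
    by (simp add: mat_adjoint_mult[of _ n n _ n] assoc_mult_mat[of _ n n _ n _ n])
  hence off: "(mat_adjoint (T * V) * (T * V)) $$ (i, j) = 0"
    if "i < n" "j < n" "i \<noteq> j" for i j
    by (simp only:) (use that in simp)
  have TVc: "T * V \<in> carrier_mat n n" using T V' by simp
  obtain W d where W: "unitary_mat n W"
    and d: "\<And>i. 0 \<le> d i" and TV: "T * V = W * diagonal_of n (\<lambda>i. complex_of_real (d i))"
    using orthogonal_columns_factorization[OF TVc] off by blast
  note W' = unitary_matD[OF W]
  define D where "D = diagonal_of n (\<lambda>i. complex_of_real (d i))"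
  have D: "D \<in> carrier_mat n n" unfolding D_def by simp
  have "T = W * D * mat_adjoint V"
    using cancel_adjoint_right(2)[OF V T] TV unfolding D_def by simp
  hence "V * mat_adjoint W * T = V * mat_adjoint W * (W * D * mat_adjoint V)" by simp
  also have "\<dots> = V * (mat_adjoint W * (W * (D * mat_adjoint V)))"
    using V' W' D by (simp add: assoc_mult_mat[of _ n n _ n _ n])
  also have "\<dots> = V * D * mat_adjoint V"
    using V' W' D by (subst cancel_adjoint(1)[OF W, of _ n]) (auto simp: assoc_mult_mat[of _ n n _ n _ n])
  finally have "V * mat_adjoint W * T = V * D * mat_adjoint V" .
  hence "psd_mat n (V * mat_adjoint W * T)"
    using psd_mat_unitary_conj_diagonal[OF V, of d] d unfolding D_def by simp
  thus ?thesis using unitary_mat_mult[OF V unitary_mat_adjoint[OF W]] by blast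
qed

section \<open>The inequality\<close>

lemma smult_mat_mult:
  fixes A B :: "complex mat"
  assumes "A \<in> carrier_mat n n" "B \<in> carrier_mat n n"
  shows "(c \<cdot>\<^sub>m A) * B = c \<cdot>\<^sub>m (A * B)" "A * (c \<cdot>\<^sub>m B) = c \<cdot>\<^sub>m (A * B)"
  using assms by (auto simp: mult_smult_assoc_mat[of _ n n _ n] mult_smult_distrib[of _ n n _ n])

lemma smult_smult_mat: "c \<cdot>\<^sub>m (d \<cdot>\<^sub>m A) = (c * d :: complex) \<cdot>\<^sub>m A"
  by (intro eq_matI) (auto simp: mult.assoc)

text \<open>The arithmetic-geometric mean inequality of Bhatia and Kittaneh, for factors with positive
  semidefinite product \<open>X = G\<^sub>1 G\<^sub>2\<^sup>*\<close>: being Hermitian, \<open>X\<close> satisfies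
  \<open>4 X + (G\<^sub>1 - G\<^sub>2) (G\<^sub>1 - G\<^sub>2)\<^sup>* = (G\<^sub>1 + G\<^sub>2) (G\<^sub>1 + G\<^sub>2)\<^sup>*\<close>.\<close>

lemma uin_amgm:
  assumes N: "unitarily_invariant_norm n N"
    and G: "G1 \<in> carrier_mat n n" "G2 \<in> carrier_mat n n"
    and X: "psd_mat n (G1 * mat_adjoint G2)"
  shows "2 * N (G1 * mat_adjoint G2) \<le> N (mat_adjoint G1 * G1 + mat_adjoint G2 * G2)"
proof -
  define X' where "X' = G1 * mat_adjoint G2"
  define H where "H = mat_adjoint G1 * G1 + mat_adjoint G2 * G2"
  define P where "P = G1 + G2"
  define M where "M = G1 - G2"
  have c: "X' \<in> carrier_mat n n" "H \<in> carrier_mat n n" "P \<in> carrier_mat n n" "M \<in> carrier_mat n n"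
    using G unfolding X'_def H_def P_def M_def by (auto intro!: minus_carrier_mat)
  have sym: "G2 * mat_adjoint G1 = X'"
    using X G unfolding psd_mat_def hermitian_mat_def X'_def by (simp add: mat_adjoint_mult[of _ n n _ n])
  have psdX: "psd_mat n X'" using X unfolding X'_def .
  have psdPP: "psd_mat n (mat_adjoint P * P)" and psdMM: "psd_mat n (mat_adjoint M * M)"
    using c by (auto intro: psd_mat_gram)
  have psdMM': "psd_mat n (M * mat_adjoint M)"
    using psd_mat_gram[of "mat_adjoint M" n] c by simp
  have sum: "P * mat_adjoint P = (X' + G2 * mat_adjoint G1) + (X' + G2 * mat_adjoint G1) + M * mat_adjoint M"
    using G unfolding P_def M_def X'_def
    by (intro eq_matI) (auto simp: scalar_prod_def algebra_simps sum.distrib sum_subtractf)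
  have four: "(X' + X') + (X' + X') = 4 \<cdot>\<^sub>m X'" using c by (intro eq_matI) auto
  \<comment> \<open>Parallelogram identity: the cross terms of the two Gram matrices cancel.\<close>
  have sum2: "mat_adjoint P * P + mat_adjoint M * M = 2 \<cdot>\<^sub>m H"
    using G unfolding P_def M_def H_def
    by (intro eq_matI) (auto simp: scalar_prod_def algebra_simps sum.distrib sum_subtractf)
  have "4 * N X' = N (4 \<cdot>\<^sub>m X')" using uin_smult[OF N c(1), of 4] by simp
  also have "\<dots> \<le> N (P * mat_adjoint P)"
    unfolding sum sym four
    by (rule uin_psd_mono[OF N _ psdMM']) (unfold four[symmetric], intro psd_mat_add psdX)
  \<comment> \<open>Exchanging the factors is what moves the adjoints to the left, the order in
    which they stand in H.\<close>
  also have "\<dots> = N (mat_adjoint P * P)" by (rule uin_gram_commute[OF N c(3), symmetric])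
  also have "\<dots> \<le> N (2 \<cdot>\<^sub>m H)" unfolding sum2[symmetric] by (rule uin_psd_mono[OF N psdPP psdMM])
  also have "\<dots> = 2 * N H" using uin_smult[OF N c(2), of 2] by simp
  finally show ?thesis unfolding X'_def H_def by simp
qed

text \<open>The witness is \<open>C = (a - Z) (Z - b)\<close>.\<close>

lemma hermitian_quadratic_bound:
  assumes Z: "hermitian_mat n Z"
    and spec: "\<And>e. eigenvalue Z e \<Longrightarrow> b \<le> Re e \<and> Re e \<le> a"
  obtains C where "psd_mat n C"
    "Z * Z + complex_of_real (a * b) \<cdot>\<^sub>m 1\<^sub>m n + C = complex_of_real (a + b) \<cdot>\<^sub>m Z"
proof -
  have Zc: "Z \<in> carrier_mat n n" using Z unfolding hermitian_mat_def by simp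
  obtain V d where V: "unitary_mat n V"
    and D: "mat_adjoint V * Z * V = diagonal_of n (\<lambda>i. complex_of_real (d i))"
    and ev: "\<And>i. i < n \<Longrightarrow> eigenvalue Z (complex_of_real (d i))"
    and "\<And>e. eigenvalue Z e \<Longrightarrow> \<exists>i<n. e = complex_of_real (d i)"
    by (rule hermitian_spectral[OF Z]) (rule that)
  note V' = unitary_matD[OF V]
  define E where "E = diagonal_of n (\<lambda>i. complex_of_real (d i))"
  define F where "F = diagonal_of n (\<lambda>i. complex_of_real ((a - d i) * (d i - b)))"
  have c: "E \<in> carrier_mat n n" "F \<in> carrier_mat n n" unfolding E_def F_def by auto
  define C where "C = V * F * mat_adjoint V"
  have ZE: "Z = V * E * mat_adjoint V"
    using adjoint_conjugation(1)[OF V Zc] unfolding D E_def by simp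
  have ZZ: "Z * Z = V * (E * E) * mat_adjoint V"
  proof -
    have "Z * Z = V * (E * (mat_adjoint V * (V * (E * mat_adjoint V))))"
      unfolding ZE using V' c by (simp add: assoc_mult_mat[of _ n n _ n _ n])
    also have "\<dots> = V * (E * (E * mat_adjoint V))"
      using V' c by (subst cancel_adjoint(1)[OF V, of _ n]) auto
    finally show ?thesis using V' c by (simp add: assoc_mult_mat[of _ n n _ n _ n])
  qed
  have one: "complex_of_real (a * b) \<cdot>\<^sub>m 1\<^sub>m n = V * (complex_of_real (a * b) \<cdot>\<^sub>m 1\<^sub>m n) * mat_adjoint V"
    using V' by (simp add: smult_mat_mult[of _ n])
  \<comment> \<open>On the diagonal this is the scalar identity d^2 + a b + (a - d) (d - b) = (a +
    b) d.\<close>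
  have EE: "E * E + complex_of_real (a * b) \<cdot>\<^sub>m 1\<^sub>m n + F = complex_of_real (a + b) \<cdot>\<^sub>m E"
    unfolding E_def F_def
    by (subst diagonal_of_mult(1)[of _ n n], simp) (auto intro!: eq_matI simp: algebra_simps)
  have "Z * Z + complex_of_real (a * b) \<cdot>\<^sub>m 1\<^sub>m n + C
      = V * (E * E + complex_of_real (a * b) \<cdot>\<^sub>m 1\<^sub>m n + F) * mat_adjoint V"
    unfolding ZZ C_def using V' c
    by (subst one) (simp add: mult_add_distrib_mat[of _ n n _ n] add_mult_distrib_mat[of _ n n _ _ n])
  also have "\<dots> = complex_of_real (a + b) \<cdot>\<^sub>m Z"
    unfolding EE ZE using V' c by (simp add: smult_mat_mult[of _ n])
  finally have "Z * Z + complex_of_real (a * b) \<cdot>\<^sub>m 1\<^sub>m n + C = complex_of_real (a + b) \<cdot>\<^sub>m Z" .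
  moreover have "psd_mat n C"
    unfolding C_def F_def
  proof (rule psd_mat_unitary_conj_diagonal[OF V])
    fix i assume "i < n"
    hence "b \<le> d i" "d i \<le> a" using spec[OF ev[of i]] by auto
    thus "0 \<le> (a - d i) * (d i - b)" by simp
  qed
  ultimately show thesis using that by blast
qed

text \<open>The factor is the square root of the Kantorovich constant. A unitary U from the polar
  decomposition makes the product positive semidefinite, so that \<open>uin_amgm\<close> applies to
  its factorisation as \<open>G1 * mat_adjoint G2\<close>; U then disappears from the Gram matrix of
  G1.\<close>

lemma uin_kantorovich:
  assumes N: "unitarily_invariant_norm n N"
    and Z: "hermitian_mat n Z"
    and spec: "\<And>e. eigenvalue Z e \<Longrightarrow> b \<le> Re e \<and> Re e \<le> a"
    and b: "0 < b" "b \<le> a"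
    and Q: "Q \<in> carrier_mat n n"
  shows "N (Z * (Q * mat_adjoint Q)) \<le> (a + b) / (2 * sqrt (a * b)) * N (mat_adjoint Q * Z * Q)"
proof -
  have Zc: "Z \<in> carrier_mat n n" and Zadj: "mat_adjoint Z = Z" using Z unfolding hermitian_mat_def by auto
  have ab: "0 < a * b" using b by simp
  \<comment> \<open>The fourth root of a b. Scaling the factors by 1 / q and q leaves their product
    alone and balances the Gram matrices: since q^4 = a b, their sum is 1 / q^2 times the matrix H,
    in which Z^2 and a b occur together as in \<open>hermitian_quadratic_bound\<close>.\<close>
  define q where "q = sqrt (sqrt (a * b))"
  have q: "0 < q" "q * q = sqrt (a * b)" "q * q * (q * q) = a * b"
    using ab unfolding q_def by simp_all
  obtain C where C: "psd_mat n C"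
    and id: "Z * Z + complex_of_real (a * b) \<cdot>\<^sub>m 1\<^sub>m n + C = complex_of_real (a + b) \<cdot>\<^sub>m Z"
    by (rule hermitian_quadratic_bound[OF Z]) (rule spec, assumption, rule that)
  note Cc = psd_mat_carrier[OF C]
  have T: "Z * (Q * mat_adjoint Q) \<in> carrier_mat n n" using Zc Q by simp
  obtain U where U: "unitary_mat n U" and psd: "psd_mat n (U * (Z * (Q * mat_adjoint Q)))"
    using polar_psd[OF T] by (elim exE conjE)
  note U' = unitary_matD[OF U]
  define G1 where "G1 = complex_of_real (1 / q) \<cdot>\<^sub>m (U * Z * Q)"
  define G2 where "G2 = complex_of_real q \<cdot>\<^sub>m Q"
  have G: "G1 \<in> carrier_mat n n" "G2 \<in> carrier_mat n n"
    using U' Zc Q unfolding G1_def G2_def by auto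
  have X: "G1 * mat_adjoint G2 = U * (Z * (Q * mat_adjoint Q))"
    unfolding G1_def G2_def using U' Zc Q q(1)
    by (simp add: mat_adjoint_smult smult_mat_mult[of _ n] assoc_mult_mat[of _ n n _ n _ n])
      (intro eq_matI; simp)
  define H where "H = mat_adjoint (Z * Q) * (Z * Q) + complex_of_real (a * b) \<cdot>\<^sub>m (mat_adjoint Q * Q)"
  have Hc: "H \<in> carrier_mat n n" using Zc Q unfolding H_def by simp
  have H: "mat_adjoint G1 * G1 + mat_adjoint G2 * G2 = complex_of_real (1 / (q * q)) \<cdot>\<^sub>m H"
  proof -
    have "mat_adjoint (U * Z * Q) * (U * Z * Q) = mat_adjoint (Z * Q) * (mat_adjoint U * (U * (Z * Q)))"
      using U' Zc Q by (simp add: mat_adjoint_mult[of _ n n _ n] assoc_mult_mat[of _ n n _ n _ n])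
    also have "\<dots> = mat_adjoint (Z * Q) * (Z * Q)"
      using U' Zc Q by (subst cancel_adjoint(1)[OF U, of _ n]) auto
    finally have 1: "mat_adjoint G1 * G1
        = (complex_of_real (1 / q) * complex_of_real (1 / q)) \<cdot>\<^sub>m (mat_adjoint (Z * Q) * (Z * Q))"
      unfolding G1_def using U' Zc Q by (simp add: mat_adjoint_smult smult_mat_mult[of _ n] smult_smult_mat)
    have 2: "mat_adjoint G2 * G2 = (complex_of_real q * complex_of_real q) \<cdot>\<^sub>m (mat_adjoint Q * Q)"
      unfolding G2_def using Q by (simp add: mat_adjoint_smult smult_mat_mult[of _ n] smult_smult_mat)
    have 3: "complex_of_real q * complex_of_real q = complex_of_real (1 / (q * q)) * complex_of_real (a * b)"
      unfolding of_real_mult[symmetric] using q(1) q(3)[symmetric] by simp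
    show ?thesis unfolding 1 2 3 H_def using Zc Q
      by (intro eq_matI) (auto simp: algebra_simps simp del: index_mult_mat(1))
  qed
  have psdH: "psd_mat n H"
  proof -
    have "complex_of_real (a * b) \<cdot>\<^sub>m (mat_adjoint Q * Q)
        = mat_adjoint (complex_of_real (q * q) \<cdot>\<^sub>m Q) * (complex_of_real (q * q) \<cdot>\<^sub>m Q)"
      unfolding q(3)[symmetric] using Q
      by (simp add: mat_adjoint_smult smult_mat_mult[of _ n] smult_smult_mat)
    thus ?thesis unfolding H_def using Zc Q by (auto intro!: psd_mat_add psd_mat_gram)
  qed
  obtain R where R: "R \<in> carrier_mat n n" "C = mat_adjoint R * R"
    using psd_mat_obtain_gram[OF C] by blast
  have psdC: "psd_mat n (mat_adjoint Q * C * Q)"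
  proof -
    have "mat_adjoint Q * C * Q = mat_adjoint (R * Q) * (R * Q)"
      using R Q by (simp add: mat_adjoint_mult[of _ n n _ n] assoc_mult_mat[of _ n n _ n _ n])
    thus ?thesis using psd_mat_gram[of "R * Q" n] R Q by simp
  qed
  \<comment> \<open>The identity for C, multiplied by Q on the right and by its adjoint on the
    left.\<close>
  have HC: "H + mat_adjoint Q * C * Q = complex_of_real (a + b) \<cdot>\<^sub>m (mat_adjoint Q * Z * Q)"
  proof -
    have "H + mat_adjoint Q * C * Q
        = mat_adjoint Q * (Z * Z + complex_of_real (a * b) \<cdot>\<^sub>m 1\<^sub>m n + C) * Q"
      unfolding H_def using Zc Q Cc Zadj
      by (simp add: mat_adjoint_mult[of _ n n _ n] assoc_mult_mat[of _ n n _ n _ n]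
          mult_add_distrib_mat[of _ n n _ n] add_mult_distrib_mat[of _ n n _ _ n] smult_mat_mult[of _ n])
    thus ?thesis unfolding id using Zc Q by (simp add: smult_mat_mult[of _ n])
  qed
  have "2 * N (Z * (Q * mat_adjoint Q)) = 2 * N (G1 * mat_adjoint G2)"
    unfolding X using uin_unitary_left[OF N T U] by simp
  also have "\<dots> \<le> N (complex_of_real (1 / (q * q)) \<cdot>\<^sub>m H)"
    unfolding H[symmetric] using uin_amgm[OF N G] psd X by simp
  also have "\<dots> = N H / (q * q)"
    using uin_smult[OF N Hc, of "complex_of_real (1 / (q * q))"] q(1)
    by (simp del: of_real_divide of_real_mult)
  also have "\<dots> \<le> N (H + mat_adjoint Q * C * Q) / (q * q)"
    using uin_psd_mono[OF N psdH psdC] q(1) by (intro divide_right_mono) auto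
  also have "N (H + mat_adjoint Q * C * Q) = (a + b) * N (mat_adjoint Q * Z * Q)"
    unfolding HC using uin_smult[OF N, of "mat_adjoint Q * Z * Q" "complex_of_real (a + b)"] b Zc Q
    by (simp del: of_real_add)
  finally show ?thesis unfolding q(2) by (simp add: field_simps)
qed

text \<open>With \<open>A * B = mat_adjoint G * G\<close>, cyclic exchange of factors leads from
  \<open>G * Z * mat_adjoint G\<close> through \<open>A * B * Z\<close> to \<open>B * Z * A\<close>
  and keeps the characteristic polynomial. The first matrix is Hermitian, the last one need not be,
  so \<open>uin_hermitian_le\<close> compares their norms.\<close>

lemma uin_product_bound:
  assumes N: "unitarily_invariant_norm n N"
    and Z: "hermitian_mat n Z"
    and spec: "\<And>e. eigenvalue Z e \<Longrightarrow> b \<le> Re e \<and> Re e \<le> a"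
    and b: "0 < b" "b \<le> a"
    and A: "A \<in> carrier_mat n n" and B: "B \<in> carrier_mat n n" and AB: "psd_mat n (A * B)"
  shows "N (Z * A * B) \<le> (a + b) / (2 * sqrt (a * b)) * N (B * Z * A)"
proof -
  have Zc: "Z \<in> carrier_mat n n" using Z unfolding hermitian_mat_def by simp
  obtain G where G: "G \<in> carrier_mat n n" and ABG: "A * B = mat_adjoint G * G"
    using psd_mat_obtain_gram[OF AB] by blast
  have "char_poly (G * Z * mat_adjoint G) = char_poly (mat_adjoint G * (G * Z))"
    using G Zc by (intro char_poly_mult_commute) auto
  also have "mat_adjoint G * (G * Z) = A * (B * Z)"
    using G Zc A B ABG by (simp flip: assoc_mult_mat[of _ n n _ n _ n])
  also have "char_poly \<dots> = char_poly (B * Z * A)"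
    using A B Zc by (intro char_poly_mult_commute) auto
  finally have cp: "char_poly (G * Z * mat_adjoint G) = char_poly (B * Z * A)" .
  have herm: "hermitian_mat n (G * Z * mat_adjoint G)"
    using hermitian_mat_congruence[OF Z, of "mat_adjoint G"] G by simp
  have "N (Z * A * B) = N (Z * (mat_adjoint G * G))"
    using Zc A B ABG by (simp add: assoc_mult_mat[of _ n n _ n _ n])
  also have "\<dots> \<le> (a + b) / (2 * sqrt (a * b)) * N (G * Z * mat_adjoint G)"
    using uin_kantorovich[OF N Z spec b, of "mat_adjoint G"] G by simp
  also have "\<dots> \<le> (a + b) / (2 * sqrt (a * b)) * N (B * Z * A)"
    using uin_hermitian_le[OF N herm _ cp] A B Zc b by (intro mult_left_mono) auto
  finally show ?thesis .
qed

section \<open>Sharpness\<close>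

text \<open>For \<open>A = B = u u\<^sup>*\<close> both sides are multiples of \<open>N (u u\<^sup>*)\<close>, because a Householder reflection
  turns \<open>D u\<close> into a multiple of \<open>u\<close>.\<close>

lemma uin_rank_one:
  fixes u d :: "nat \<Rightarrow> real"
  assumes N: "unitarily_invariant_norm n N"
    and s: "s = (\<Sum>i<n. (u i)\<^sup>2)" "0 < s"
    and t: "t = (\<Sum>i<n. d i * (u i)\<^sup>2)" "0 < t"
    and r: "r = (\<Sum>i<n. (d i)\<^sup>2 * (u i)\<^sup>2)"
  defines "D \<equiv> diagonal_of n (\<lambda>i. complex_of_real (d i))"
    and "A \<equiv> mat n n (\<lambda>(i,j). complex_of_real (u i * u j))"
  shows "N (D * (A * A)) = sqrt (r * s) * N A" "N (A * D * A) = t * N A" "0 < N A" "mat_adjoint A = A"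
proof -
  have A: "A \<in> carrier_mat n n" and D: "D \<in> carrier_mat n n" unfolding A_def D_def by auto
  show adj: "mat_adjoint A = A" unfolding A_def by (intro eq_matI) (auto simp: mult.commute)
  have DA: "D * A = mat n n (\<lambda>(i,j). complex_of_real (d i * u i * u j))"
    unfolding D_def using A by (subst diagonal_of_mult(1)[of _ n n]) (auto simp: A_def intro!: eq_matI)
  have AA: "A * A = complex_of_real s \<cdot>\<^sub>m A"
    unfolding s A_def
    by (intro eq_matI) (auto simp: scalar_prod_def lessThan_atLeast0 sum_distrib_left power2_eq_square
        mult_ac intro!: sum.cong)
  have ADA: "A * D * A = complex_of_real t \<cdot>\<^sub>m A"
    unfolding assoc_mult_mat[OF A D A] DA unfolding t A_def
    by (intro eq_matI) (auto simp: scalar_prod_def lessThan_atLeast0 sum_distrib_left power2_eq_square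
        mult_ac intro!: sum.cong)
  show "N (A * D * A) = t * N A" unfolding ADA using uin_smult[OF N A] t(2) by simp
  have "\<exists>i<n. u i \<noteq> 0"
  proof (rule ccontr)
    assume "\<not> ?thesis"
    hence "s = 0" unfolding s(1) by (intro sum.neutral) auto
    thus False using s(2) by simp
  qed
  then obtain i where i: "i < n" "u i \<noteq> 0" by blast
  have "A \<noteq> 0\<^sub>m n n"
  proof
    assume "A = 0\<^sub>m n n"
    hence "A $$ (i,i) = 0" using i(1) by simp
    thus False using i unfolding A_def by simp
  qed
  thus "0 < N A" using uin_nonneg[OF N A] uin_eq_0[OF N A] by linarith
  have r0: "0 \<le> r" unfolding r by (intro sum_nonneg) auto
  \<comment> \<open>Here s and r are the squared norms of u and D u, and t is the inner product of u
    with D u. Thus \<kappa> u has the same norm as D u, as a reflection between the two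
    requires.\<close>
  define \<kappa> where "\<kappa> = sqrt (r / s)"
  have \<kappa>: "0 \<le> \<kappa>" "\<kappa>\<^sup>2 * s = r" unfolding \<kappa>_def using r0 s(2) by auto
  define x where "x = vec n (\<lambda>i. complex_of_real (d i * u i))"
  define y where "y = vec n (\<lambda>i. complex_of_real (\<kappa> * u i))"
  have xy: "x \<in> carrier_vec n" "y \<in> carrier_vec n" unfolding x_def y_def by auto
  have "(cmod (x $ i))\<^sup>2 = (d i)\<^sup>2 * (u i)\<^sup>2" if "i < n" for i
    using that unfolding x_def by (simp add: norm_mult power_mult_distrib)
  hence "(\<Sum>i<n. (cmod (x $ i))\<^sup>2) = r" unfolding r by (intro sum.cong) auto
  hence xx: "x \<bullet>c x = complex_of_real r" unfolding conjugate_square_real by (simp add: x_def)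
  have "(cmod (y $ i))\<^sup>2 = \<kappa>\<^sup>2 * (u i)\<^sup>2" if "i < n" for i
    using that unfolding y_def by (simp add: norm_mult power_mult_distrib)
  hence "(\<Sum>i<n. (cmod (y $ i))\<^sup>2) = \<kappa>\<^sup>2 * s"
    unfolding s(1) sum_distrib_left by (intro sum.cong) auto
  hence "y \<bullet>c y = complex_of_real (\<kappa>\<^sup>2 * s)" unfolding conjugate_square_real by (simp add: y_def)
  hence norm: "x \<bullet>c x = y \<bullet>c y" using xx \<kappa>(2) by simp
  have real: "x \<bullet>c y = y \<bullet>c x"
    unfolding x_def y_def by (simp add: scalar_prod_def mult_ac)
  obtain U where U: "unitary_mat n U" and "mat_adjoint U = U" and Ux: "U *\<^sub>v x = y"
    by (rule unitary_mat_maps_to[OF xy norm real]) (rule that)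
  note U' = unitary_matD[OF U]
  \<comment> \<open>Column j of \<open>D * A\<close> is u j times x, and U sends it to u j times y,
    which is \<kappa> times column j of A.\<close>
  have UDA: "U * (D * A) = complex_of_real \<kappa> \<cdot>\<^sub>m A"
  proof (rule eq_matI)
    fix i j assume "i < dim_row (complex_of_real \<kappa> \<cdot>\<^sub>m A)" "j < dim_col (complex_of_real \<kappa> \<cdot>\<^sub>m A)"
    hence ij: "i < n" "j < n" using A by auto
    have "(U * (D * A)) $$ (i,j) = (\<Sum>k<n. U $$ (i,k) * complex_of_real (d k * u k)) * complex_of_real (u j)"
      unfolding DA using ij U' by (simp add: scalar_prod_def lessThan_atLeast0 sum_distrib_left mult_ac)
    also have "(\<Sum>k<n. U $$ (i,k) * complex_of_real (d k * u k)) = (U *\<^sub>v x) $ i"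
      using ij U' unfolding x_def by (simp add: scalar_prod_def lessThan_atLeast0)
    also have "(U *\<^sub>v x) $ i = complex_of_real (\<kappa> * u i)" unfolding Ux y_def using ij by simp
    finally show "(U * (D * A)) $$ (i,j) = (complex_of_real \<kappa> \<cdot>\<^sub>m A) $$ (i,j)"
      using ij unfolding A_def by simp
  qed (use U' A in auto)
  have "U * (D * (A * A)) = U * (D * A) * A"
    using U' D A by (simp add: assoc_mult_mat[of _ n n _ n _ n])
  also have "\<dots> = (complex_of_real (\<kappa> * s)) \<cdot>\<^sub>m A"
    unfolding UDA using A by (simp add: smult_mat_mult[of _ n] AA smult_smult_mat)
  finally have "N (D * (A * A)) = N (complex_of_real (\<kappa> * s) \<cdot>\<^sub>m A)"
    using uin_unitary_left[OF N _ U, of "D * (A * A)"] D A by simp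
  also have "\<dots> = \<kappa> * s * N A"
    using uin_smult[OF N A, of "complex_of_real (\<kappa> * s)"] \<kappa>(1) s(2) by (simp add: norm_mult)
  also have "\<kappa> * s = sqrt (r * s)"
  proof (rule real_sqrt_unique[symmetric])
    show "(\<kappa> * s)\<^sup>2 = r * s" using \<kappa>(2) by (simp add: power2_eq_square mult_ac)
  qed (use \<kappa>(1) s(2) in simp)
  finally show "N (D * (A * A)) = sqrt (r * s) * N A" .
qed

text \<open>The extremal rank one matrix is built in an eigenbasis of Z and carried back by V; its
  construction does not depend on N.\<close>

lemma uin_product_bound_attained:
  assumes N: "unitarily_invariant_norm n N"
    and Z: "hermitian_mat n Z"
    and a: "eigenvalue Z (complex_of_real a)" and b: "eigenvalue Z (complex_of_real b)"
    and pos: "0 < a" "0 < b"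
  obtains A where "A \<in> carrier_mat n n" "psd_mat n (A * A)" "0 < N (A * Z * A)"
    "N (Z * A * A) = (a + b) / (2 * sqrt (a * b)) * N (A * Z * A)"
proof -
  have Zc: "Z \<in> carrier_mat n n" using Z unfolding hermitian_mat_def by simp
  obtain V d where V: "unitary_mat n V"
    and VD: "mat_adjoint V * Z * V = diagonal_of n (\<lambda>i. complex_of_real (d i))"
    and "\<And>i. i < n \<Longrightarrow> eigenvalue Z (complex_of_real (d i))"
    and ev: "\<And>e. eigenvalue Z e \<Longrightarrow> \<exists>i<n. e = complex_of_real (d i)"
    by (rule hermitian_spectral[OF Z]) (rule that)
  note V' = unitary_matD[OF V]
  obtain k where k: "k < n" "a = d k" using ev[OF a] by auto
  obtain l where l: "l < n" "b = d l" using ev[OF b] by auto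
  \<comment> \<open>The weights are crossed: sqrt b stands at the eigenvalue a and sqrt a at the
    eigenvalue b, so that both contribute a b to t. If k = l, then a = b, u has a single nonzero
    entry, and the constant is 1.\<close>
  define u where "u i = (if i = k then sqrt b else if i = l then sqrt a else 0)" for i
  have sum_u: "(\<Sum>i<n. f i * (u i)\<^sup>2) = (if k = l then f k * b else f k * b + f l * a)" for f
  proof -
    have "(\<Sum>i<n. f i * (u i)\<^sup>2)
        = (\<Sum>i<n. (if i = k then f k * b else 0) + (if i = l then (if k = l then 0 else f l * a) else 0))"
      using pos by (intro sum.cong) (auto simp: u_def)
    thus ?thesis using k l by (simp add: sum.distrib)
  qed
  define s where "s = (\<Sum>i<n. (u i)\<^sup>2)"
  define t where "t = (\<Sum>i<n. d i * (u i)\<^sup>2)"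
  define r where "r = (\<Sum>i<n. (d i)\<^sup>2 * (u i)\<^sup>2)"
  have s: "s = (if k = l then b else b + a)" using sum_u[of "\<lambda>_. 1"] unfolding s_def by simp
  have t: "t = (if k = l then a * b else 2 * (a * b))" using sum_u[of d] k l unfolding t_def by simp
  have r: "r = (if k = l then a * (a * b) else a * b * (a + b))"
    using sum_u[of "\<lambda>i. (d i)\<^sup>2"] k l unfolding r_def by (simp add: power2_eq_square algebra_simps)
  have s0: "0 < s" and t0: "0 < t" using pos unfolding s t by auto
  \<comment> \<open>For k distinct from l this rests on r s = a b (a + b)^2 and t = 2 a b.\<close>
  have const: "sqrt (r * s) = (a + b) / (2 * sqrt (a * b)) * t"
  proof (cases "k = l")
    case True
    hence "a = b" using k l by simp
    thus ?thesis using True pos unfolding r s t by (simp add: real_sqrt_mult)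
  next
    case False
    have "r * s = (sqrt (a * b) * (a + b))\<^sup>2"
      using False pos unfolding r s by (simp add: power2_eq_square algebra_simps)
    hence "sqrt (r * s) = sqrt (a * b) * (a + b)" using pos by simp
    moreover have "t = 2 * (sqrt (a * b) * sqrt (a * b))" using False pos unfolding t by simp
    ultimately show ?thesis using pos by (simp add: field_simps)
  qed
  define D where "D = diagonal_of n (\<lambda>i. complex_of_real (d i))"
  define A0 where "A0 = mat n n (\<lambda>(i,j). complex_of_real (u i * u j))"
  note rank_one = uin_rank_one[OF N s_def s0 t_def t0 r_def, folded D_def A0_def]
  have c: "D \<in> carrier_mat n n" "A0 \<in> carrier_mat n n" unfolding D_def A0_def by auto
  define A where "A = V * A0 * mat_adjoint V"
  have A: "A \<in> carrier_mat n n" unfolding A_def using V' c by simp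
  have ZV: "Z = V * D * mat_adjoint V"
    using adjoint_conjugation(1)[OF V Zc] unfolding VD D_def by simp
  \<comment> \<open>Conjugation by V is multiplicative and preserves the norm, so both sides can be
    evaluated with D and A0.\<close>
  have conj: "(V * X * mat_adjoint V) * (V * Y * mat_adjoint V) = V * (X * Y) * mat_adjoint V"
    if "X \<in> carrier_mat n n" "Y \<in> carrier_mat n n" for X Y
  proof -
    have "(V * X * mat_adjoint V) * (V * Y * mat_adjoint V)
        = V * (X * (mat_adjoint V * (V * (Y * mat_adjoint V))))"
      using V' that by (simp add: assoc_mult_mat[of _ n n _ n _ n])
    also have "\<dots> = V * (X * (Y * mat_adjoint V))"
      using V' that by (subst cancel_adjoint(1)[OF V, of _ n]) auto
    finally show ?thesis using V' that by (simp add: assoc_mult_mat[of _ n n _ n _ n])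
  qed
  have norm: "N (V * X * mat_adjoint V) = N X" if "X \<in> carrier_mat n n" for X
    using uin_conj[OF N that unitary_mat_adjoint[OF V]] by simp
  have "Z * A * A = V * (D * (A0 * A0)) * mat_adjoint V"
    unfolding ZV A_def using c by (simp add: conj assoc_mult_mat[of _ n n _ n _ n])
  hence 1: "N (Z * A * A) = sqrt (r * s) * N A0" using norm c rank_one(1) by simp
  have "A * Z * A = V * (A0 * D * A0) * mat_adjoint V"
    unfolding ZV A_def using c by (simp add: conj)
  hence 2: "N (A * Z * A) = t * N A0" using norm c rank_one(2) by simp
  have "mat_adjoint A = A"
    unfolding A_def using V' c rank_one(4)
    by (simp add: mat_adjoint_mult[of _ n n _ n] assoc_mult_mat[of _ n n _ n _ n])
  hence "psd_mat n (A * A)" using psd_mat_gram[OF A] by simp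
  moreover have "0 < N (A * Z * A)" unfolding 2 using t0 rank_one(3) by simp
  ultimately show thesis using that A 1 2 const by simp
qed

text \<open>Sharpness is stated for each Z and each norm separately: a smaller factor fails already
  for any single choice of both, and not only for the whole class.\<close>

theorem theorem1p2:
  fixes n :: nat and Z :: "complex mat" and a b :: real
  assumes "n \<ge> 1"
    and "Z \<in> carrier_mat n n"
    and "pd_mat n Z"
    and "largest_eigenvalue Z a"
    and "smallest_eigenvalue Z b"
  shows "(\<forall>N. unitarily_invariant_norm n N \<longrightarrow>
            (\<forall>A \<in> carrier_mat n n. \<forall>B \<in> carrier_mat n n. psd_mat n (A * B) \<longrightarrow>
               N (Z * A * B) \<le> (a + b) / (2 * sqrt (a * b)) * N (B * Z * A)))
       \<and> (\<forall>N. unitarily_invariant_norm n N \<longrightarrow>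
            (\<forall>c < (a + b) / (2 * sqrt (a * b)).
               \<exists>A \<in> carrier_mat n n. \<exists>B \<in> carrier_mat n n. psd_mat n (A * B) \<and>
                 \<not> (N (Z * A * B) \<le> c * N (B * Z * A))))"
proof -
  have Z: "hermitian_mat n Z" using assms(3) unfolding pd_mat_def by simp
  have ev: "eigenvalue Z (complex_of_real a)" "eigenvalue Z (complex_of_real b)"
    using assms(4,5) unfolding largest_eigenvalue_def smallest_eigenvalue_def by auto
  have spec: "b \<le> Re e \<and> Re e \<le> a" if "eigenvalue Z e" for e
    using assms(4,5) that unfolding largest_eigenvalue_def smallest_eigenvalue_def by auto
  have pos: "0 < a" "0 < b" using assms(3) ev unfolding pd_mat_def by auto
  have ba: "b \<le> a" using spec[OF ev(1)] by simp
  show ?thesis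
  proof (intro conjI allI impI ballI)
    fix N A B
    assume "unitarily_invariant_norm n N" "A \<in> carrier_mat n n" "B \<in> carrier_mat n n" "psd_mat n (A * B)"
    thus "N (Z * A * B) \<le> (a + b) / (2 * sqrt (a * b)) * N (B * Z * A)"
      by (intro uin_product_bound[OF _ Z spec pos(2) ba])
  next
    fix N c
    assume N: "unitarily_invariant_norm n N" and c: "c < (a + b) / (2 * sqrt (a * b))"
    obtain A where A: "A \<in> carrier_mat n n" "psd_mat n (A * A)" and p: "0 < N (A * Z * A)"
      and eq: "N (Z * A * A) = (a + b) / (2 * sqrt (a * b)) * N (A * Z * A)"
      by (rule uin_product_bound_attained[OF N Z ev pos]) (rule that)
    \<comment> \<open>Since N (A * Z * A) is positive, equality with the exact constant becomes
      strict failure for c, with B = A.\<close>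
    have "c * N (A * Z * A) < N (Z * A * A)" unfolding eq using c p by (rule mult_strict_right_mono)
    thus "\<exists>A \<in> carrier_mat n n. \<exists>B \<in> carrier_mat n n. psd_mat n (A * B) \<and>
        \<not> (N (Z * A * B) \<le> c * N (B * Z * A))"
      using A by (intro bexI[of _ A] conjI) auto
  qed
qed

end
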